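(* Let $p/q$ be an even rational parameter with $p>1$ and $\kappa\ge1$, and let $\widehat p/\widehat q$ be the core predecessor of $p/q$. Let $\Pi$ and $\widehat\Pi$ be the unions of the plaid polygons with respect to $p/q$ and $\widehat p/\widehat q$ respectively. Let $\omega=p+q$, $\widehat\omega=\widehat p+\widehat q$, let $\Upsilon$ be the vertical translation $\Upsilon(x,y)=(x,\,y+(\omega-\widehat\omega)/2)$, and put $\widehat\Sigma=R_{\widehat p/\widehat q}$, $\Sigma=\Upsilon(\widehat\Sigma)$. Then $\Sigma\cap\Pi=\Upsilon(\widehat\Sigma\cap\widehat\Pi)$.
   Context: Plaid model. An even rational parameter is a rational $p/q\in(0,1)$ in lowest terms with $pq$ even. Put $\omega=p+q$, $P=2p/\omega$, $Q=2q/\omega$. Consider four families of lines: $\mathcal H$ (horizontal lines with integer $y$-coordinate), $\mathcal V$ (vertical lines with integer $x$-coordinate), $\mathcal P$ (slope $-P$, integer $y$-intercept), $\mathcal Q$ (slope $-Q$, integer $y$-intercept). Define functions with values in $\mathbb{R}/2\mathbb{Z}$, represented in $[-1,1)$: $F_H=2Py$, $F_V=2Px$, $F_P=Py+P^2x+1$, $F_Q=Py+PQx+1$. The capacity of a line $L$ in $\mathcal H$ or $\mathcal V$ is $|\omega F_H(L)|$ or $|\omega F_V(L)|$ respectively. If $z$ is on an $\mathcal A$ line ($A\in\{H,V\}$) and on a $\mathcal B$ line ($B\in\{P,Q\}$), then $z$ is light (for these lines) if $|F_B(z)|<|F_A(z)|$ and $F_A(z)F_B(z)>0$. The unit segments are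 the edges of the unit squares $[a,a+1]\times[b,b+1]$, $a,b\in\mathbb{Z}$. A unit segment contained in an $\mathcal A$ line is good if it contains exactly one point which is light with respect to that $\mathcal A$ line and some $\mathcal P$ or $\mathcal Q$ line, where a light point at the midpoint of a horizontal unit segment is counted twice. It is known that each unit square has $0$ or $2$ good edges. In each unit square with two good edges draw the segments joining the center of the square to the centers of its good edges. The resulting embedded closed polygons are the plaid polygons. For an even rational parameter $p/q$, $R_{p/q}$ is the rectangle bounded by the bottom, left and top of the first block $[0,\omega]^2$ and by whichever $\mathcal V$ line of positive capacity at most $4$ in the first block is closest to the left edge. Number theory. The tune $\tau$ of $p/q$ is the unique integer in $(0,\omega/2)$ with $2p\tau\equiv\pm1\bmod\omega$. The integer $\kappa\ge0$ is determined by $\frac{\kappa}{2\kappa+1}\le\frac{\tau}{\omega}<\frac{\kappa+1}{2(\kappa+1)+1}$. The even predecessor of $p/q$ is the unique rational $p'/q'$ in lowest terms with $p'q'$ even, $|pq'-p'q|=1$ and $p'+q'<p+q$. The core predecessor is $\widehat p/\widehat q$ with $\widehat p=p-2\kappa p'$, $\widehat q=q-2\kappa q'$; it is an even rational parameter in $(0,1)$ when $p>1$. *)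

theory Defs
  imports "HOL-Analysis.Analysis" "HOL-Number_Theory.Cong"
begin

definition even_param :: "int \<Rightarrow> int \<Rightarrow> bool" where
  "even_param p q \<longleftrightarrow> 0 < p \<and> p < q \<and> coprime p q \<and> even (p * q)"

definition slopeP :: "int \<Rightarrow> int \<Rightarrow> real" where
  "slopeP p q = 2 * of_int p / of_int (p + q)"

definition slopeQ :: "int \<Rightarrow> int \<Rightarrow> real" where
  "slopeQ p q = 2 * of_int q / of_int (p + q)"

text \<open>The representative in \<open>[-1, 1)\<close> of the class of a real number modulo \<open>2\<int>\<close>.\<close>

definition mod2 :: "real \<Rightarrow> real" where
  "mod2 t = 2 * frac ((t + 1) / 2) - 1"

definition hline :: "int \<Rightarrow> (real \<times> real) set" where
  "hline n = {(x, y). y = of_int n}"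

definition vline :: "int \<Rightarrow> (real \<times> real) set" where
  "vline n = {(x, y). x = of_int n}"

datatype grid = Hor | Ver

fun grid_lines :: "grid \<Rightarrow> (real \<times> real) set set" where
  "grid_lines Hor = range hline"
| "grid_lines Ver = range vline"

datatype slanted = PLine | QLine

fun slanted_slope :: "int \<Rightarrow> int \<Rightarrow> slanted \<Rightarrow> real" where
  "slanted_slope p q PLine = - slopeP p q"
| "slanted_slope p q QLine = - slopeQ p q"

definition slanted_lines :: "int \<Rightarrow> int \<Rightarrow> slanted \<Rightarrow> (real \<times> real) set set" where
  "slanted_lines p q B = range (\<lambda>n. {(x, y). y = slanted_slope p q B * x + of_int n})"

fun grid_fun :: "int \<Rightarrow> int \<Rightarrow> grid \<Rightarrow> real \<times> real \<Rightarrow> real" where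
  "grid_fun p q Hor (x, y) = mod2 (2 * slopeP p q * y)"
| "grid_fun p q Ver (x, y) = mod2 (2 * slopeP p q * x)"

text \<open>The coefficient of \<open>y\<close> is \<open>P\<close> in both cases.\<close>

fun slanted_fun :: "int \<Rightarrow> int \<Rightarrow> slanted \<Rightarrow> real \<times> real \<Rightarrow> real" where
  "slanted_fun p q PLine (x, y) = mod2 (slopeP p q * y + (slopeP p q)\<^sup>2 * x + 1)"
| "slanted_fun p q QLine (x, y) = mod2 (slopeP p q * y + slopeP p q * slopeQ p q * x + 1)"

text \<open>Since \<open>grid_fun p q Ver\<close> is constant on every vertical line, evaluating it at one point of
  the line gives its value on the line.\<close>

definition v_capacity :: "int \<Rightarrow> int \<Rightarrow> int \<Rightarrow> real" where
  "v_capacity p q n = \<bar>of_int (p + q) * grid_fun p q Ver (of_int n, 0)\<bar>"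

definition light :: "int \<Rightarrow> int \<Rightarrow> grid \<Rightarrow> slanted \<Rightarrow> real \<times> real \<Rightarrow> bool" where
  "light p q A B z \<longleftrightarrow>
     z \<in> \<Union>(grid_lines A) \<and> z \<in> \<Union>(slanted_lines p q B) \<and>
     \<bar>slanted_fun p q B z\<bar> < \<bar>grid_fun p q A z\<bar> \<and>
     grid_fun p q A z * slanted_fun p q B z > 0"

text \<open>The unit segment of direction \<open>A\<close> whose lower or left endpoint is \<open>(a, b)\<close>.\<close>

fun unit_seg :: "grid \<Rightarrow> int \<times> int \<Rightarrow> (real \<times> real) set" where
  "unit_seg Hor (a, b) = closed_segment (of_int a, of_int b) (of_int a + 1, of_int b)"
| "unit_seg Ver (a, b) = closed_segment (of_int a, of_int b) (of_int a, of_int b + 1)"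

fun seg_center :: "grid \<Rightarrow> int \<times> int \<Rightarrow> real \<times> real" where
  "seg_center Hor (a, b) = (of_int a + 1/2, of_int b)"
| "seg_center Ver (a, b) = (of_int a, of_int b + 1/2)"

definition light_points :: "int \<Rightarrow> int \<Rightarrow> grid \<Rightarrow> int \<times> int \<Rightarrow> (real \<times> real) set" where
  "light_points p q A c = {z \<in> unit_seg A c. \<exists>B. light p q A B z}"

text \<open>Light points are counted as points, not as pairs of a point and a slanted line; the two
  endpoints belong to the segment. For \<open>p, q > 0\<close> only finitely many slanted
  lines meet a unit segment, so the sum is over a finite set.\<close>

definition light_count :: "int \<Rightarrow> int \<Rightarrow> grid \<Rightarrow> int \<times> int \<Rightarrow> nat" where
  "light_count p q A c =
     (\<Sum>z \<in> light_points p q A c. if A = Hor \<and> z = seg_center Hor c then 2 else 1)"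

definition good :: "int \<Rightarrow> int \<Rightarrow> grid \<Rightarrow> int \<times> int \<Rightarrow> bool" where
  "good p q A c \<longleftrightarrow> light_count p q A c = 1"

definition square_edges :: "int \<times> int \<Rightarrow> (grid \<times> (int \<times> int)) set" where
  "square_edges = (\<lambda>(a, b). {(Hor, (a, b)), (Hor, (a, b + 1)), (Ver, (a, b)), (Ver, (a + 1, b))})"

definition good_edges :: "int \<Rightarrow> int \<Rightarrow> int \<times> int \<Rightarrow> (grid \<times> (int \<times> int)) set" where
  "good_edges p q c = {(A, e) \<in> square_edges c. good p q A e}"

definition square_center :: "int \<times> int \<Rightarrow> real \<times> real" where
  "square_center = (\<lambda>(a, b). (of_int a + 1/2, of_int b + 1/2))"

definition connectors :: "int \<Rightarrow> int \<Rightarrow> (real \<times> real) set set" where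
  "connectors p q =
     {closed_segment (square_center c) (seg_center A e) | c A e.
        card (good_edges p q c) = 2 \<and> (A, e) \<in> good_edges p q c}"

text \<open>The individual polygons are the connected components of the union of all drawn segments.\<close>

definition plaid_polygons :: "int \<Rightarrow> int \<Rightarrow> (real \<times> real) set set" where
  "plaid_polygons p q = components (\<Union>(connectors p q))"

definition plaid_union :: "int \<Rightarrow> int \<Rightarrow> (real \<times> real) set" where
  "plaid_union p q = \<Union>(plaid_polygons p q)"

definition right_line :: "int \<Rightarrow> int \<Rightarrow> int" where
  "right_line p q =
     Min {n \<in> {0..p + q}. 0 < v_capacity p q n \<and> v_capacity p q n \<le> 4}"

definition R_rect :: "int \<Rightarrow> int \<Rightarrow> (real \<times> real) set" where
  "R_rect p q = {0..of_int (right_line p q)} \<times> {0..of_int (p + q)}"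

definition is_tune :: "int \<Rightarrow> int \<Rightarrow> int \<Rightarrow> bool" where
  "is_tune p q \<tau> \<longleftrightarrow>
     0 < \<tau> \<and> real_of_int \<tau> < of_int (p + q) / 2 \<and>
     ([2 * p * \<tau> = 1] (mod (p + q)) \<or> [2 * p * \<tau> = - 1] (mod (p + q)))"

definition is_kappa :: "int \<Rightarrow> int \<Rightarrow> int \<Rightarrow> nat \<Rightarrow> bool" where
  "is_kappa p q \<tau> \<kappa> \<longleftrightarrow>
     real \<kappa> / (2 * real \<kappa> + 1) \<le> of_int \<tau> / of_int (p + q) \<and>
     of_int \<tau> / of_int (p + q) < (real \<kappa> + 1) / (2 * (real \<kappa> + 1) + 1)"

text \<open>The denominator \<open>q'\<close> of a fraction in lowest terms is positive; the sign of \<open>p'\<close> is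
  unrestricted.\<close>

definition is_even_pred :: "int \<Rightarrow> int \<Rightarrow> int \<Rightarrow> int \<Rightarrow> bool" where
  "is_even_pred p q p' q' \<longleftrightarrow>
     0 < q' \<and> coprime p' q' \<and> even (p' * q') \<and> \<bar>p * q' - p' * q\<bar> = 1 \<and> p' + q' < p + q"

text \<open>The core predecessor as a pair (numerator, denominator), computed from \<open>\<kappa>\<close> and the even
  predecessor \<open>p'/q'\<close>.\<close>

definition core_pred :: "int \<Rightarrow> int \<Rightarrow> nat \<Rightarrow> int \<Rightarrow> int \<Rightarrow> int \<times> int" where
  "core_pred p q \<kappa> p' q' = (p - 2 * int \<kappa> * p', q - 2 * int \<kappa> * q')"

definition Upsilon :: "int \<Rightarrow> int \<Rightarrow> real \<times> real \<Rightarrow> real \<times> real" where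
  "Upsilon \<omega> \<omega>h = (\<lambda>(x, y). (x, y + of_int (\<omega> - \<omega>h) / 2))"

end

theory Submission
  imports Defs
begin

text \<open>
  Write \<open>w\<close>, \<open>w'\<close>, \<open>wh\<close> for numerator plus denominator of the parameter, of its even predecessor and
  of its core predecessor. Then \<open>p w' = p' w + e\<close> and \<open>ph w' = p' wh + e\<close> with the same sign \<open>e\<close>,
  \<open>w = wh + 2 \<kappa> w'\<close> and \<open>w' < wh < 3 w'\<close>, and the right side of the rectangle is \<open>x = (wh - w') / 2\<close>.
  Measure heights from the middle of the block, so that the translation disappears. If a slanted line
  has intercept \<open>M / 2 = (k w' + 2 wh j) / 2\<close>, its value is \<open>e k / wh\<close> for the core predecessor, and
  from \<open>M = (k - 4 \<kappa> j) w' + 2 w j\<close> it is \<open>e (k - 4 \<kappa> j) / w\<close> for the parameter. Similarly the values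
  on the grid line at height or abscissa \<open>B / 2 = (l w' + wh i) / 2\<close> are \<open>2 e l / wh\<close> and
  \<open>2 e (l - 2 \<kappa> i) / w\<close>. In the rectangle \<open>k\<close> and \<open>j\<close> have opposite signs, and so do \<open>2 l - k\<close> and
  \<open>i - j\<close>; hence both parameters have the same light points. The exceptions come from values
  that pass through \<open>\<plusminus>1\<close>. On at most two horizontal lines, those where the grid value does so,
  light and dark are interchanged, but each unit segment carries exactly two candidate points, so
  its goodness does not change; on the other lines a slanted line whose value does so stays dark.
\<close>

text \<open>The number \<open>w'\<close> occurs because \<open>p * w'\<close> is \<open>e\<close>
  modulo \<open>w\<close> and \<open>ph * w'\<close> is \<open>e\<close> modulo \<open>wh\<close>:
  up to sign it inverts both numerators, so one decomposition along \<open>w'\<close> shows the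
  values for both parameters. Its size bounds are the two inequalities that define \<kappa>,
  rewritten with \<open>w' = w - 2 * \<tau>\<close>.

  The sides of the rectangle are the obstacle beyond the transfer of goodness. On the left, bottom
  and top sides the value for the core predecessor is zero, hence no edge there is good, for either
  parameter. The right side does carry good edges, and a square to the right of it can meet the
  rectangle in the center of such an edge; the comparison says nothing about whether that square is
  drawn. It therefore has to be shown that the square to the left draws this center: a good right
  edge forces exactly one more good edge among the other three. The value \<open>-2 * e / wh\<close>
  of the right side pins down the light point, which leaves a finite case analysis. It is carried
  out for the core predecessor and transferred.\<close>

section \<open>The light condition over the integers\<close>

text \<open>\<open>smod w t\<close> is \<open>w * mod2 (t / w)\<close>; in \<open>lit w c m\<close> the numbers \<open>c / w\<close> and \<open>m / w\<close> represent the
  values of the functions of the grid line and of the slanted line.\<close>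

definition smod :: "int \<Rightarrow> int \<Rightarrow> int" where
  "smod w t = (t + w) mod (2 * w) - w"

definition lit :: "int \<Rightarrow> int \<Rightarrow> int \<Rightarrow> bool" where
  "lit w c m \<longleftrightarrow> 0 < smod w m \<and> smod w m < smod w c \<or> smod w c < smod w m \<and> smod w m < 0"

lemma smod_cong: "smod w (t + 2 * w * z) = smod w t"
proof -
  have "t + 2 * w * z + w = t + w + (2 * w) * z" by simp
  then show ?thesis unfolding smod_def by (simp only: mod_mult_self2)
qed

lemma smod_congI: "t = u + 2 * w * z \<Longrightarrow> smod w t = smod w u"
  by (simp add: smod_cong)

lemma smod_id: "- w \<le> t \<Longrightarrow> t < w \<Longrightarrow> smod w t = t"
  unfolding smod_def by simp

lemma smod_id_abs: "\<bar>t\<bar> < w \<Longrightarrow> smod w t = t"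
  by (rule smod_id) auto

lemma smod_range: "w > 0 \<Longrightarrow> - w \<le> smod w t \<and> smod w t < w"
  unfolding smod_def using pos_mod_bound[of "2 * w" "t + w"] pos_mod_sign[of "2 * w" "t + w"] by linarith

lemma smod_edge: "w > 0 \<Longrightarrow> smod w w = - w"
  unfolding smod_def by simp

lemma smod_zero: "w > 0 \<Longrightarrow> smod w 0 = 0"
  by (rule smod_id) auto

lemma lit_cong:
  assumes "c = c' + 2 * w * y" "m = m' + 2 * w * z"
  shows "lit w c m = lit w c' m'"
  unfolding lit_def using smod_congI[OF assms(1)] smod_congI[OF assms(2)] by simp

lemma smod_exists: obtains z where "t = smod w t + 2 * w * z"
proof
  show "t = smod w t + 2 * w * ((t + w) div (2 * w))"
    unfolding smod_def using mult_div_mod_eq[of "2 * w" "t + w"] by linarith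
qed

lemma odd_smod:
  assumes "odd w" shows "odd (smod w t) = odd t"
proof -
  obtain z where "t = smod w t + 2 * w * z" by (rule smod_exists)
  then have "t - smod w t = 2 * (w * z)" by linarith
  then have "even (t - smod w t)" by (metis dvd_triv_left)
  then show ?thesis by simp
qed

lemma smod_if:
  assumes "w > 0" "- 3 * w \<le> t" "t < 3 * w"
  shows "smod w t = (if t < - w then t + 2 * w else if t < w then t else t - 2 * w)"
proof -
  have "smod w t = smod w (t + 2 * w)" "smod w t = smod w (t - 2 * w)"
    using smod_cong[of w t 1] smod_cong[of w t "-1"] by simp_all
  then show ?thesis using assms smod_id[of w t] smod_id[of w "t + 2 * w"] smod_id[of w "t - 2 * w"] by auto
qed

lemma smod_minus:
  assumes "w > 0" shows "smod w (- t) = (if smod w t = - w then - w else - smod w t)"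
proof -
  obtain z where z: "t = smod w t + 2 * w * z" by (rule smod_exists)
  have "smod w (- t) = smod w (- smod w t)"
    by (rule smod_congI[of _ _ _ "- z"]) (use z in simp)
  then show ?thesis using smod_if[OF assms, of "- smod w t"] smod_range[OF assms, of t] by auto
qed

text \<open>For representatives in range, light means that \<open>m\<close> lies strictly between
  \<open>0\<close> and \<open>c\<close>, and replacing \<open>m\<close> by \<open>c - m\<close>
  reverses this interval. If the difference leaves the range, then \<open>m\<close> was dark and the
  wrapped difference is dark too.\<close>

lemma lit_reflect:
  assumes "w > 0" shows "lit w c (c - m) = lit w c m"
proof -
  obtain y where y: "c = smod w c + 2 * w * y" by (rule smod_exists)
  obtain z where z: "m = smod w m + 2 * w * z" by (rule smod_exists)
  have "smod w (c - m) = smod w (smod w c - smod w m)"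
    by (rule smod_congI[of _ _ _ "y - z"]) (use y z in \<open>simp add: right_diff_distrib\<close>)
  then show ?thesis unfolding lit_def
    using smod_if[OF assms, of "smod w c - smod w m"] smod_range[OF assms, of c] smod_range[OF assms, of m]
    by (auto split: if_splits)
qed

text \<open>Negation disagrees with the choice of representatives only at \<open>-w\<close>. An even
  \<open>c\<close> avoids this value because \<open>w\<close> is odd, and an \<open>m\<close>
  represented by \<open>-w\<close> is dark on both sides.\<close>

lemma lit_minus:
  assumes "w > 0" "odd w" "even c" shows "lit w (- c) (- m) = lit w c m"
proof -
  have "smod w c \<noteq> - w" using odd_smod[OF assms(2), of c] assms by (metis even_minus)
  then show ?thesis unfolding lit_def smod_minus[OF assms(1)]
    using smod_range[OF assms(1), of c] smod_range[OF assms(1), of m] by auto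
qed

text \<open>The endpoint \<open>\<bar>m\<bar> = w\<close> is allowed: both signs represent
  \<open>-w\<close>, which lies beyond \<open>c\<close> and is never light, in agreement with the
  right side.\<close>

lemma lit_eval:
  assumes e: "e = 1 \<or> e = -1" and c: "\<bar>c\<bar> < w" and m: "\<bar>m\<bar> \<le> w"
  shows "lit w (e * c) (e * m) \<longleftrightarrow> 0 < m \<and> m < c \<or> c < m \<and> m < 0"
proof -
  have w: "w > 0" using c by linarith
  have ec: "smod w (e * c) = e * c" using e c by (intro smod_id_abs) auto
  show ?thesis
  proof (cases "\<bar>m\<bar> = w")
    case True
    then have "smod w (e * m) = - w"
      using e w smod_edge[OF w] smod_id[of w "- w"] by (auto simp: abs_if split: if_splits)
    then show ?thesis unfolding lit_def ec using e c True by auto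
  next
    case False
    then have "smod w (e * m) = e * m" using e m by (intro smod_id_abs) auto
    then show ?thesis unfolding lit_def ec using e by auto
  qed
qed

lemma opposite_signs:
  fixes k j u v M :: int
  assumes M: "M = k * u + v * j" "\<bar>M\<bar> < u + v" and u: "u > 0" and v: "v > 0"
  shows "k > 0 \<Longrightarrow> j \<le> 0" "k < 0 \<Longrightarrow> j \<ge> 0"
proof -
  show "j \<le> 0" if "k > 0"
  proof (rule ccontr)
    assume "\<not> j \<le> 0"
    then have "1 * u \<le> k * u" "v * 1 \<le> v * j" using that u v by (auto intro: mult_mono)
    then show False using M by linarith
  qed
  show "j \<ge> 0" if "k < 0"
  proof (rule ccontr)
    assume "\<not> j \<ge> 0"
    then have "k * u \<le> (-1) * u" "v * j \<le> v * (-1)"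
      using that u v mult_right_mono[of k "-1" u] mult_left_mono[of j "-1" v] by auto
    then show False using M by linarith
  qed
qed

section \<open>Comparison of the light conditions for the two parameters\<close>

text \<open>Here \<open>n\<close> stands for \<open>\<kappa>\<close> and \<open>w1\<close> for \<open>p' + q'\<close>.\<close>

locale core_arith =
  fixes w w1 wh n e h :: int
  assumes w: "w = wh + 2 * n * w1" and n: "n \<ge> 1" and e: "e = 1 \<or> e = -1"
    and w1: "w1 = 2 * h - 1" and w1_ge: "w1 \<ge> 3" and wh_odd: "odd wh"
    and wh_gt: "w1 < wh" and wh_lt: "wh < 3 * w1"
begin

lemma w_gt: "w > 4 * n"
proof -
  have "n * 3 \<le> n * w1" using n w1_ge by (intro mult_left_mono) auto
  then show ?thesis using w n w1_ge wh_gt by linarith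
qed

lemma n_h_eq: "2 * (n * (2 * h - 2)) = w - wh - 2 * n"
  unfolding w w1 by (simp add: algebra_simps)

text \<open>As \<open>w1 = 2 * h - 1\<close>, the hypothesis says
  \<open>2 * \<bar>j\<bar> \<le> w1 - 1\<close>, and \<open>2 * n * w1 = w - wh\<close>. The
  leftover \<open>2 * n\<close> is the room that keeps the values away from the wrap at
  \<open>w\<close>.\<close>

lemma n_abs_le:
  assumes "\<bar>j\<bar> \<le> h - 1" shows "4 * \<bar>n * j\<bar> \<le> w - wh - 2 * n"
proof -
  have "n * \<bar>j\<bar> \<le> n * (h - 1)" using assms n by (intro mult_left_mono) auto
  then show ?thesis using n_h_eq n by (simp add: abs_mult algebra_simps)
qed

lemma mass_bound:
  assumes "\<bar>k\<bar> \<le> wh" "\<bar>j\<bar> \<le> h - 1" shows "\<bar>k - 4 * n * j\<bar> \<le> w - 2 * n"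
  using n_abs_le[OF assms(2)] assms(1) by (simp add: algebra_simps)

lemma cap_bound:
  assumes "2 * \<bar>l\<bar> \<le> wh - 1" "\<bar>i\<bar> \<le> h - 1" shows "\<bar>2 * (l - 2 * n * i)\<bar> \<le> w - 1 - 2 * n"
  using n_abs_le[OF assms(2)] assms(1) by (simp add: algebra_simps)

text \<open>For \<open>\<bar>j\<bar> < h\<close> the number \<open>k - 4 * n * j\<close> represents its residue class modulo \<open>2 * w\<close> in
  \<open>[-w, w]\<close>, by \<open>mass_bound\<close>; outside this range only two values of \<open>k\<close> occur.\<close>

lemma mass_wrap:
  assumes M: "M = k * w1 + 2 * wh * j" "\<bar>M\<bar> < 2 * wh + w1" and k: "odd k" "\<bar>k\<bar> \<le> wh" and j: "j \<ge> h"
  shows "j = h \<and> (k = - wh \<or> k = - wh + 2)"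
proof -
  have "- wh * w1 \<le> k * w1" using k w1_ge by (intro mult_right_mono) auto
  moreover have jh: "j = h"
  proof (rule ccontr)
    assume "j \<noteq> h"
    then have "wh * (h + 1) \<le> wh * j" using j wh_gt w1_ge by (intro mult_left_mono) auto
    then have "M \<ge> 3 * wh" using calculation M w1 by (simp add: algebra_simps)
    then show False using M wh_gt by linarith
  qed
  have "M = wh + (wh + k) * w1" unfolding M(1) jh by (simp add: w1 algebra_simps)
  then have "(wh + k) * w1 < 4 * w1" using M(2) wh_lt by linarith
  then have "wh + k < 4" using w1_ge by (simp add: mult_less_cancel_right)
  moreover have "wh + k \<ge> 0" using k by linarith
  moreover have "even (wh + k)" using k wh_odd by simp
  ultimately have "wh + k = 0 \<or> wh + k = 2" by presburger
  with jh show ?thesis by linarith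
qed

text \<open>At \<open>j = h\<close> the value has crossed \<open>-w\<close> and returns as
  \<open>w - 2 * n + s\<close> with \<open>s = 0\<close> or \<open>s = 2\<close>: positive and
  beyond the bound \<open>w - 1 - 2 * n\<close> on grid values, hence dark. For \<open>wh\<close>,
  \<open>i < j\<close> gives \<open>2 * l \<ge> k\<close>, and \<open>k < 0\<close>, hence dark too.
  The sign \<open>e'\<close> is free so that the mirror image \<open>- j \<ge> h\<close> is covered
  by \<open>- e\<close>.\<close>

lemma not_lit_mass_wrap:
  assumes e: "e' = 1 \<or> e' = -1" and M: "M = k * w1 + 2 * wh * j" "\<bar>M\<bar> < 2 * wh + w1"
    and k: "odd k" "\<bar>k\<bar> \<le> wh" and B: "B = l * w1 + wh * i" and MB: "\<bar>2 * B - M\<bar> < 2 * wh + w1"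
    and l: "2 * \<bar>l\<bar> \<le> wh - 1" and i: "\<bar>i\<bar> \<le> h - 1" and j: "j \<ge> h"
  shows "\<not> (0 < k \<and> k < 2 * l \<or> 2 * l < k \<and> k < 0)"
    "\<not> lit w (e' * (2 * (l - 2 * n * i))) (e' * (k - 4 * n * j))"
proof -
  obtain s where s: "k = - wh + s" "s = 0 \<or> s = 2" and jh: "j = h"
    using mass_wrap[OF M k j] by (metis add.right_neutral)
  have k0: "k < 0" using s wh_gt w1_ge by linarith
  have D: "2 * B - M = (2 * l - k) * w1 + (2 * wh) * (i - j)" unfolding B M(1) by (simp add: algebra_simps)
  have "i - j < 0" using i j by linarith
  then have "\<not> 2 * l - k < 0" using opposite_signs(2)[OF D] MB w1_ge wh_gt by linarith
  then show "\<not> (0 < k \<and> k < 2 * l \<or> 2 * l < k \<and> k < 0)" using k0 by linarith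
  have K: "e' * (k - 4 * n * j) + 2 * w * e' = e' * (w - 2 * n + s)"
    unfolding s jh w w1 by (simp add: algebra_simps)
  have "\<bar>w - 2 * n + s\<bar> \<le> w" using s n w_gt by linarith
  moreover have cb: "\<bar>2 * (l - 2 * n * i)\<bar> \<le> w - 1 - 2 * n" by (rule cap_bound[OF l i])
  ultimately have "lit w (e' * (2 * (l - 2 * n * i))) (e' * (w - 2 * n + s)) \<longleftrightarrow>
    0 < w - 2 * n + s \<and> w - 2 * n + s < 2 * (l - 2 * n * i) \<or> 2 * (l - 2 * n * i) < w - 2 * n + s \<and> w - 2 * n + s < 0"
    using n by (intro lit_eval[OF e]) auto
  moreover have "\<not> \<dots>" using cb s w_gt n by linarith
  moreover have "lit w (e' * (2 * (l - 2 * n * i))) (e' * (k - 4 * n * j))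
     = lit w (e' * (2 * (l - 2 * n * i))) (e' * (w - 2 * n + s))"
    by (rule lit_cong[where y = 0 and z = "- e'"]) (use K in \<open>simp_all add: algebra_simps\<close>)
  ultimately show "\<not> lit w (e' * (2 * (l - 2 * n * i))) (e' * (k - 4 * n * j))" by blast
qed

lemma lit_normal:
  assumes M: "M = k * w1 + 2 * wh * j" "\<bar>M\<bar> < 2 * wh + w1"
    and k: "odd k" "\<bar>k\<bar> \<le> wh" and B: "B = l * w1 + wh * i" and MB: "\<bar>2 * B - M\<bar> < 2 * wh + w1"
    and l: "2 * \<bar>l\<bar> \<le> wh - 1" and i: "\<bar>i\<bar> \<le> h - 1"
  shows "lit w (e * (2 * (l - 2 * n * i))) (e * (k - 4 * n * j)) \<longleftrightarrow> lit wh (e * (2 * l)) (e * k)"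
proof -
  have hat: "lit wh (e * (2 * l)) (e * k) \<longleftrightarrow> 0 < k \<and> k < 2 * l \<or> 2 * l < k \<and> k < 0"
    by (rule lit_eval[OF e]) (use l k in auto)
  consider "j \<ge> h" | "- j \<ge> h" | "\<bar>j\<bar> \<le> h - 1" by linarith
  then show ?thesis
  proof cases
    case 1
    show ?thesis unfolding hat using not_lit_mass_wrap[OF e M k B MB l i 1] by blast
  next
    case 2
    \<comment> \<open>Reflection in the middle of the block negates \<open>M\<close>,
      \<open>B\<close>, \<open>k\<close>, \<open>j\<close>, \<open>l\<close> and \<open>i\<close>;
      with the sign \<open>- e\<close> the arguments of \<open>lit\<close> stay the same.\<close>
    have e': "- e = 1 \<or> - e = -1" using e by auto
    have "- M = (- k) * w1 + 2 * wh * (- j)" "\<bar>- M\<bar> < 2 * wh + w1" "odd (- k)" "\<bar>- k\<bar> \<le> wh"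
      "- B = (- l) * w1 + wh * (- i)" "\<bar>2 * (- B) - (- M)\<bar> < 2 * wh + w1" "2 * \<bar>- l\<bar> \<le> wh - 1" "\<bar>- i\<bar> \<le> h - 1"
      using M k B MB l i by auto
    note * = not_lit_mass_wrap[OF e' this 2]
    have "- e * (2 * (- l - 2 * n * - i)) = e * (2 * (l - 2 * n * i))" "- e * (- k - 4 * n * - j) = e * (k - 4 * n * j)"
      by (simp_all add: algebra_simps)
    with * show ?thesis unfolding hat by (auto simp only: )
  next
    case 3
    have big: "lit w (e * (2 * (l - 2 * n * i))) (e * (k - 4 * n * j)) \<longleftrightarrow>
      0 < k - 4 * n * j \<and> k - 4 * n * j < 2 * (l - 2 * n * i) \<or> 2 * (l - 2 * n * i) < k - 4 * n * j \<and> k - 4 * n * j < 0"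
      by (rule lit_eval[OF e]) (use cap_bound[OF l i] mass_bound[OF k(2) 3] n in auto)
    have D: "2 * B - M = (2 * l - k) * w1 + (2 * wh) * (i - j)" unfolding B M(1) by (simp add: algebra_simps)
    have pos: "0 < w1" "0 < 2 * wh" using w1_ge wh_gt by auto
    have MB': "\<bar>2 * B - M\<bar> < w1 + 2 * wh" "\<bar>M\<bar> < w1 + 2 * wh" using MB M by auto
    have A: "k - 4 * n * j > 0 \<longleftrightarrow> k > 0" "k - 4 * n * j < 0 \<longleftrightarrow> k < 0"
    proof -
      have "k \<noteq> 0" using k by auto
      moreover have "n * j \<le> 0" if "k > 0"
        using opposite_signs(1)[OF M(1) MB'(2) pos] that n by (simp add: mult_le_0_iff)
      moreover have "n * j \<ge> 0" if "k < 0"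
        using opposite_signs(2)[OF M(1) MB'(2) pos] that n by (simp add: zero_le_mult_iff)
      ultimately show "k - 4 * n * j > 0 \<longleftrightarrow> k > 0" "k - 4 * n * j < 0 \<longleftrightarrow> k < 0"
        unfolding mult.assoc by linarith+
    qed
    have A': "k - 4 * n * j < 2 * (l - 2 * n * i) \<longleftrightarrow> k < 2 * l" "2 * (l - 2 * n * i) < k - 4 * n * j \<longleftrightarrow> 2 * l < k"
    proof -
      have ne: "2 * l - k \<noteq> 0" using k by presburger
      moreover have 1: "n * (i - j) \<le> 0" if "2 * l - k > 0"
        using opposite_signs(1)[OF D MB'(1) pos that] n by (simp add: mult_le_0_iff)
      moreover have 2: "n * (i - j) \<ge> 0" if "2 * l - k < 0"
        using opposite_signs(2)[OF D MB'(1) pos that] n by (simp add: zero_le_mult_iff)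
      moreover have "2 * (l - 2 * n * i) - (k - 4 * n * j) = (2 * l - k) - 4 * (n * (i - j))" by (simp add: algebra_simps)
      ultimately show "k - 4 * n * j < 2 * (l - 2 * n * i) \<longleftrightarrow> k < 2 * l" "2 * (l - 2 * n * i) < k - 4 * n * j \<longleftrightarrow> 2 * l < k"
        by linarith+
    qed
    show ?thesis unfolding hat big A A' ..
  qed
qed

text \<open>\<open>l = 0\<close>, \<open>i = 1\<close> describes the top line of the block of the
  core predecessor: its value is zero for \<open>wh\<close>, but \<open>-4 * n\<close> up to sign
  for \<open>w\<close>. A light point would satisfy \<open>-4 * n < k - 4 * n * j\<close> and
  \<open>k - 4 * n * j < 0\<close>, which forces \<open>k < 0\<close> and \<open>j = 0\<close>, so
  that \<open>M = k * w1 \<le> - w1\<close>.\<close>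

lemma not_lit_zero_line:
  assumes e: "e' = 1 \<or> e' = -1" and M: "M = k * w1 + 2 * wh * j" "\<bar>M\<bar> < 2 * wh + w1"
    and k: "odd k" "\<bar>k\<bar> \<le> wh" and M': "M > - w1"
  shows "\<not> lit w (e' * (2 * (0 - 2 * n * 1))) (e' * (k - 4 * n * j))"
proof -
  have cb: "\<bar>2 * (0 - 2 * n * 1)\<bar> < w" using w_gt n by simp
  have pos: "0 < w1" "0 < 2 * wh" using w1_ge wh_gt by auto
  have M2: "\<bar>M\<bar> < w1 + 2 * wh" using M by auto
  have k0: "k \<noteq> 0" using k by auto
  consider "j \<ge> h" | "- j \<ge> h" | "\<bar>j\<bar> \<le> h - 1" by linarith
  then show ?thesis
  proof cases
    case 1
    then obtain s where s: "k = - wh + s" "s = 0 \<or> s = 2" and jh: "j = h"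
      using mass_wrap[OF M k] by (metis add.right_neutral)
    have K: "e' * (k - 4 * n * j) + 2 * w * e' = e' * (w - 2 * n + s)"
      unfolding s jh w w1 by (simp add: algebra_simps)
    have "lit w (e' * (2 * (0 - 2 * n * 1))) (e' * (w - 2 * n + s)) \<longleftrightarrow>
      0 < w - 2 * n + s \<and> w - 2 * n + s < 2 * (0 - 2 * n * 1) \<or> 2 * (0 - 2 * n * 1) < w - 2 * n + s \<and> w - 2 * n + s < 0"
      by (rule lit_eval[OF e cb]) (use w_gt n s in auto)
    moreover have "\<not> \<dots>" using w_gt n s by auto
    moreover have "lit w (e' * (2 * (0 - 2 * n * 1))) (e' * (k - 4 * n * j))
       = lit w (e' * (2 * (0 - 2 * n * 1))) (e' * (w - 2 * n + s))"
      by (rule lit_cong[where y = 0 and z = "- e'"]) (use K in \<open>simp_all add: algebra_simps\<close>)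
    ultimately show ?thesis by blast
  next
    case 2
    have "\<bar>- M\<bar> < 2 * wh + w1" "- M = - k * w1 + 2 * wh * - j" "odd (- k)" "\<bar>- k\<bar> \<le> wh" using M k by auto
    from mass_wrap[OF this(2,1,3,4) 2] obtain s where s: "- k = - wh + s" "s = 0 \<or> s = 2" and jh: "- j = h"
      by (metis add.right_neutral)
    have j2: "2 * j = - (w1 + 1)" using jh w1 by linarith
    have "M = k * w1 + wh * (2 * j)" using M(1) by simp
    then have "M = - wh - (wh - k) * w1" unfolding j2 by (simp add: algebra_simps)
    moreover have "(wh - k) * w1 \<ge> 0" using k w1_ge by simp
    ultimately show ?thesis using M' wh_gt by linarith
  next
    case 3
    have ev: "lit w (e' * (2 * (0 - 2 * n * 1))) (e' * (k - 4 * n * j)) \<longleftrightarrow>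
      0 < k - 4 * n * j \<and> k - 4 * n * j < 2 * (0 - 2 * n * 1) \<or> 2 * (0 - 2 * n * 1) < k - 4 * n * j \<and> k - 4 * n * j < 0"
      by (rule lit_eval[OF e cb]) (use mass_bound[OF k(2) 3] n in auto)
    have "\<not> (- 4 * n < k - 4 * n * j \<and> k - 4 * n * j < 0)"
    proof
      assume *: "- 4 * n < k - 4 * n * j \<and> k - 4 * n * j < 0"
      have "k < 0"
      proof (rule ccontr)
        assume "\<not> k < 0"
        then have "n * j \<le> 0" using k0 opposite_signs(1)[OF M(1) M2 pos] n by (simp add: mult_le_0_iff)
        with * \<open>\<not> k < 0\<close> show False by (simp add: mult.assoc)
      qed
      then have j0: "j \<ge> 0" using opposite_signs(2)[OF M(1) M2 pos] by simp
      have "4 * n * (j - 1) = 4 * n * j - 4 * n" by (simp add: algebra_simps)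
      then have "4 * n * (j - 1) < 0" using * \<open>k < 0\<close> by linarith
      then have "j = 0" using n j0 by (simp add: mult_less_0_iff)
      moreover have "k * w1 \<le> (-1) * w1" using \<open>k < 0\<close> w1_ge by (intro mult_right_mono) auto
      ultimately show False using M' M by simp
    qed
    then show ?thesis unfolding ev using n by (auto; linarith)
  qed
qed

text \<open>The grid value crosses \<open>-w\<close> and returns as \<open>w + 1 - 2 * n\<close>.
  For \<open>wh\<close> the light \<open>k\<close> are the negative ones other than
  \<open>- wh\<close>, as \<open>k\<close> is odd; for \<open>w\<close> the light values are the
  positive ones below \<open>w + 1 - 2 * n\<close>. The slanted values that cross as well,
  \<open>- wh\<close> and \<open>- wh + 2\<close> at \<open>j = h\<close>, become
  \<open>w - 2 * n\<close> and \<open>w - 2 * n + 2\<close>, just below and just above this bound,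
  so they are interchanged too. The bound \<open>- wh < M\<close> excludes \<open>k = - wh\<close>
  for smaller \<open>j\<close>.\<close>

lemma lit_flip:
  assumes e: "e' = 1 \<or> e' = -1" and M: "M = k * w1 + 2 * wh * j" "- wh < M" "M < 2 * wh + w1"
    and k: "odd k" "\<bar>k\<bar> \<le> wh" and l: "2 * l = - (wh - 1)"
  shows "lit w (e' * (2 * (l - 2 * n * h))) (e' * (k - 4 * n * j)) \<longleftrightarrow> \<not> lit wh (e' * (2 * l)) (e' * k)"
proof -
  let ?c = "w + 1 - 2 * n"
  have C: "lit w (e' * (2 * (l - 2 * n * h))) m = lit w (e' * ?c) m" for m
  proof (rule lit_cong[where y = "- e'" and z = 0])
    have "2 * (l - 2 * n * h) = ?c - 2 * w" using l unfolding w w1 by (simp add: algebra_simps)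
    then have "e' * (2 * (l - 2 * n * h)) = e' * (?c - 2 * w)" by (simp only:)
    then show "e' * (2 * (l - 2 * n * h)) = e' * ?c + 2 * w * - e'" by (simp add: algebra_simps)
  qed simp
  have cb: "\<bar>?c\<bar> < w" using w_gt n by simp
  have ev: "lit w (e' * ?c) (e' * m) \<longleftrightarrow> 0 < m \<and> m < ?c" if "\<bar>m\<bar> \<le> w" for m
    using lit_eval[OF e cb that] w_gt n by linarith
  have pos: "0 < w1" "0 < 2 * wh" using w1_ge wh_gt by auto
  have Mb: "\<bar>M\<bar> < w1 + 2 * wh" "\<bar>M\<bar> < 2 * wh + w1" using M w1_ge by auto
  have k0: "k \<noteq> 0" using k by auto
  have hat: "lit wh (e' * (2 * l)) (e' * k) \<longleftrightarrow> 0 < k \<and> k < 2 * l \<or> 2 * l < k \<and> k < 0"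
    by (rule lit_eval[OF e]) (use l k wh_gt w1_ge in auto)
  have hat': "lit wh (e' * (2 * l)) (e' * k) \<longleftrightarrow> k < 0 \<and> k \<noteq> - wh"
  proof -
    have "k = - wh \<or> k > - wh + 1" if "k < 0" using k wh_odd that by presburger
    then show ?thesis unfolding hat using l wh_gt w1_ge by linarith
  qed
  consider "k > 0" | "k < 0" "j \<ge> h" | "k < 0" "j \<le> h - 1" using k0 by linarith
  then show ?thesis
  proof cases
    case 1
    then have j0: "j \<le> 0" using opposite_signs(1)[OF M(1) Mb(1) pos] by simp
    have "k * w1 \<le> wh * w1" using k w1_ge by (intro mult_right_mono) auto
    then have "wh * (2 * (- j)) < wh * (w1 + 1)" using M by (simp add: algebra_simps)
    then have "2 * (- j) < w1 + 1" by (subst (asm) mult_less_cancel_left_pos) (use wh_gt w1_ge in auto)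
    then have "\<bar>j\<bar> \<le> h - 1" using w1 j0 by linarith
    note b = mass_bound[OF k(2) this]
    have "n * j \<le> 0" using j0 n by (simp add: mult_le_0_iff)
    then have "k - 4 * n * j > 0" using 1 by (simp add: mult.assoc)
    then show ?thesis unfolding hat' C using b ev[of "k - 4 * n * j"] n 1 by simp
  next
    case 2
    from 2 obtain s where s: "k = - wh + s" "s = 0 \<or> s = 2" and jh: "j = h"
      using mass_wrap[OF M(1) Mb(2) k] by (metis add.right_neutral)
    have K: "e' * (k - 4 * n * j) + 2 * w * e' = e' * (w - 2 * n + s)"
      unfolding s jh w w1 by (simp add: algebra_simps)
    have "lit w (e' * ?c) (e' * (k - 4 * n * j)) = lit w (e' * ?c) (e' * (w - 2 * n + s))"
      by (rule lit_cong[where y = 0 and z = "- e'"]) (use K in \<open>simp_all add: algebra_simps\<close>)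
    also have "\<dots> \<longleftrightarrow> s = 0" using ev[of "w - 2 * n + s"] s w_gt n by auto
    finally show ?thesis unfolding hat' C using s wh_gt w1_ge by auto
  next
    case 3
    then have j0: "j \<ge> 0" using opposite_signs(2)[OF M(1) Mb(1) pos] by simp
    then have "\<bar>j\<bar> \<le> h - 1" using 3 by simp
    note b = mass_bound[OF k(2) this]
    have "n * j \<ge> 0" using j0 n by simp
    then have "k - 4 * n * j < 0" using 3 by (simp add: mult.assoc)
    moreover have "k \<noteq> - wh"
    proof
      assume kk: "k = - wh"
      then have "M = wh * (2 * j - w1)" using M(1) by (simp add: algebra_simps)
      also have "\<dots> \<le> wh * (- 1)" using 3 w1 wh_gt w1_ge by (intro mult_left_mono) auto
      finally show False using M by linarith
    qed
    ultimately show ?thesis unfolding hat' C using b ev[of "k - 4 * n * j"] n 3 by simp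
  qed
qed

end

section \<open>Good unit segments\<close>

lemma mod2_of_int:
  assumes "w > 0"
  shows "mod2 (of_int t / of_int w) = of_int (smod w t) / of_int w"
proof -
  have "(of_int t / of_int w + 1) / 2 = (of_int (t + w) / of_int (2 * w) :: real)"
    using assms by (simp add: field_simps)
  moreover have "frac (of_int (t + w) / of_int (2 * w) :: real) = of_int ((t + w) mod (2 * w)) / of_int (2 * w)"
  proof -
    have "of_int (t + w) = (of_int (2 * w) * of_int ((t + w) div (2 * w)) + of_int ((t + w) mod (2 * w)) :: real)"
      by (metis mult_div_mod_eq of_int_add of_int_mult)
    then show ?thesis using assms unfolding frac_def floor_divide_of_int_eq by (simp add: field_simps)
  qed
  ultimately show ?thesis unfolding mod2_def smod_def using assms by (simp add: field_simps)
qed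

lemma slope_sum:
  assumes "p + q > 0" shows "slopeP p q + slopeQ p q = 2"
proof -
  have "slopeP p q + slopeQ p q = 2 * of_int (p + q) / of_int (p + q)"
    unfolding slopeP_def slopeQ_def add_divide_distrib[symmetric] by simp
  moreover have "of_int (p + q) \<noteq> (0 :: real)" using assms by (simp only: of_int_eq_0_iff)
  ultimately show ?thesis by (metis nonzero_mult_div_cancel_right)
qed

lemma slopeP_int_eq:
  assumes "p + q > 0" "slopeP p q * of_int c = of_int r"
  shows "2 * p * c = r * (p + q)"
proof -
  have "of_int (p + q) \<noteq> (0 :: real)" using assms(1) by (simp only: of_int_eq_0_iff)
  moreover have "of_int (2 * p * c) / of_int (p + q) = (of_int r :: real)"
    using assms(2) unfolding slopeP_def by simp
  ultimately have "(of_int (2 * p * c) :: real) = of_int r * of_int (p + q)"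
    by (metis nonzero_divide_eq_eq)
  then show ?thesis by (simp only: of_int_eq_iff flip: of_int_mult)
qed

lemma lit_real:
  assumes "w > 0"
  shows "\<bar>of_int (smod w m) / of_int w\<bar> < \<bar>of_int (smod w c) / of_int w :: real\<bar> \<and>
     of_int (smod w c) / of_int w * (of_int (smod w m) / of_int w) > (0 :: real) \<longleftrightarrow> lit w c m"
proof -
  have "\<bar>of_int (smod w m) / of_int w\<bar> < \<bar>of_int (smod w c) / of_int w :: real\<bar> \<longleftrightarrow> \<bar>smod w m\<bar> < \<bar>smod w c\<bar>"
    using assms by (simp add: abs_divide divide_less_cancel flip: of_int_abs)
  moreover have "of_int (smod w c) / of_int w * (of_int (smod w m) / of_int w) > (0 :: real) \<longleftrightarrow> smod w c * smod w m > 0"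
    using assms by (simp add: zero_less_mult_iff zero_less_divide_iff divide_less_0_iff)
  ultimately show ?thesis unfolding lit_def by (auto simp: zero_less_mult_iff)
qed

text \<open>Both functions are \<open>P\<close> times the intercept plus 1, since
  \<open>P * y + P\<^sup>2 * x = P * (y + P * x)\<close>, and likewise with \<open>Q\<close>. Hence
  the light condition depends on the intercept but not on the slope.\<close>

lemma slanted_fun_on_line:
  assumes "p + q > 0" and "y = slanted_slope p q B * x + of_int n"
  shows "slanted_fun p q B (x, y) = of_int (smod (p + q) (2 * p * n + (p + q))) / of_int (p + q)"
proof -
  have "of_int (2 * p * n + (p + q)) / of_int (p + q) = slopeP p q * of_int n + 1"
  proof -
    have "of_int (p + q) \<noteq> (0 :: real)" using assms(1) by (simp only: of_int_eq_0_iff)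
    then show ?thesis unfolding slopeP_def of_int_add[of "2 * p * n"] add_divide_distrib by simp
  qed
  then have m: "mod2 (slopeP p q * of_int n + 1) = of_int (smod (p + q) (2 * p * n + (p + q))) / of_int (p + q)"
    using mod2_of_int[OF assms(1), of "2 * p * n + (p + q)"] by (simp only:)
  show ?thesis
  proof (cases B)
    case PLine
    then have n: "of_int n = y + slopeP p q * x" using assms(2) by simp
    have "slopeP p q * y + (slopeP p q)\<^sup>2 * x + 1 = slopeP p q * of_int n + 1"
      unfolding n by (simp add: algebra_simps power2_eq_square)
    then show ?thesis using m PLine by (simp only: slanted_fun.simps)
  next
    case QLine
    then have n: "of_int n = y + slopeQ p q * x" using assms(2) by simp
    have "slopeP p q * y + slopeP p q * slopeQ p q * x + 1 = slopeP p q * of_int n + 1"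
      unfolding n by (simp add: algebra_simps)
    then show ?thesis using m QLine by (simp only: slanted_fun.simps)
  qed
qed

lemma grid_fun_int:
  assumes "p + q > 0"
  shows "grid_fun p q Hor (x, of_int b) = of_int (smod (p + q) (4 * p * b)) / of_int (p + q)"
    "grid_fun p q Ver (of_int a, y) = of_int (smod (p + q) (4 * p * a)) / of_int (p + q)"
  using mod2_of_int[OF assms, of "4 * p * b"] mod2_of_int[OF assms, of "4 * p * a"]
  unfolding grid_fun.simps slopeP_def by simp_all

lemma slanted_lines_mem:
  "(x, y) \<in> \<Union>(slanted_lines p q B) \<longleftrightarrow> (\<exists>n. y = slanted_slope p q B * x + of_int n)"
  unfolding slanted_lines_def by auto

lemma light_Hor:
  assumes w: "p + q > 0"
  shows "light p q Hor B (x, of_int b) \<longleftrightarrow>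
    (\<exists>n. of_int b = slanted_slope p q B * x + of_int n \<and> lit (p + q) (4 * p * b) (2 * p * n + (p + q)))"
proof -
  have "(x, of_int b) \<in> \<Union>(grid_lines Hor)" by (auto simp: hline_def)
  moreover have "\<bar>slanted_fun p q B (x, of_int b)\<bar> < \<bar>grid_fun p q Hor (x, of_int b)\<bar> \<and>
      grid_fun p q Hor (x, of_int b) * slanted_fun p q B (x, of_int b) > 0 \<longleftrightarrow>
      lit (p + q) (4 * p * b) (2 * p * n + (p + q))"
    if "of_int b = slanted_slope p q B * x + of_int n" for n
    by (simp only: slanted_fun_on_line[OF w that] grid_fun_int[OF w] lit_real[OF w])
  ultimately show ?thesis unfolding light_def slanted_lines_mem by blast
qed

lemma light_Ver:
  assumes w: "p + q > 0"
  shows "light p q Ver B (of_int a, y) \<longleftrightarrow>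
    (\<exists>n. y = slanted_slope p q B * of_int a + of_int n \<and> lit (p + q) (4 * p * a) (2 * p * n + (p + q)))"
proof -
  have "(of_int a, y) \<in> \<Union>(grid_lines Ver)" by (auto simp: vline_def)
  moreover have "\<bar>slanted_fun p q B (of_int a, y)\<bar> < \<bar>grid_fun p q Ver (of_int a, y)\<bar> \<and>
      grid_fun p q Ver (of_int a, y) * slanted_fun p q B (of_int a, y) > 0 \<longleftrightarrow>
      lit (p + q) (4 * p * a) (2 * p * n + (p + q))"
    if "y = slanted_slope p q B * of_int a + of_int n" for n
    by (simp only: slanted_fun_on_line[OF w that] grid_fun_int[OF w] lit_real[OF w])
  ultimately show ?thesis unfolding light_def slanted_lines_mem by blast
qed

lemma ex_slanted: "(\<exists>B. R B) \<longleftrightarrow> R PLine \<or> R QLine"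
  by (metis slanted.exhaust)

section \<open>Candidate light points of a unit segment\<close>

lemma unit_seg_mem:
  "z \<in> unit_seg Hor (a, b) \<longleftrightarrow> (\<exists>x. z = (x, of_int b) \<and> of_int a \<le> x \<and> x \<le> of_int a + 1)"
  "z \<in> unit_seg Ver (a, b) \<longleftrightarrow> (\<exists>y. z = (of_int a, y) \<and> of_int b \<le> y \<and> y \<le> of_int b + 1)"
proof -
  show "z \<in> unit_seg Hor (a, b) \<longleftrightarrow> (\<exists>x. z = (x, of_int b) \<and> of_int a \<le> x \<and> x \<le> of_int a + 1)"
  proof
    assume "z \<in> unit_seg Hor (a, b)"
    then obtain u where "0 \<le> u" "u \<le> 1" "z = (1 - u) *\<^sub>R (of_int a, of_int b) + u *\<^sub>R (of_int a + 1, of_int b)"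
      by (auto simp: closed_segment_def)
    then show "\<exists>x. z = (x, of_int b) \<and> of_int a \<le> x \<and> x \<le> of_int a + 1"
      by (intro exI[of _ "of_int a + u"]) (auto simp: algebra_simps)
  next
    assume "\<exists>x. z = (x, of_int b) \<and> of_int a \<le> x \<and> x \<le> of_int a + 1"
    then obtain x where "z = (x, of_int b)" "of_int a \<le> x" "x \<le> of_int a + 1" by blast
    then show "z \<in> unit_seg Hor (a, b)"
      by (auto simp: closed_segment_def algebra_simps intro!: exI[of _ "x - of_int a"])
  qed
  show "z \<in> unit_seg Ver (a, b) \<longleftrightarrow> (\<exists>y. z = (of_int a, y) \<and> of_int b \<le> y \<and> y \<le> of_int b + 1)"
  proof
    assume "z \<in> unit_seg Ver (a, b)"
    then obtain u where "0 \<le> u" "u \<le> 1" "z = (1 - u) *\<^sub>R (of_int a, of_int b) + u *\<^sub>R (of_int a, of_int b + 1)"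
      by (auto simp: closed_segment_def)
    then show "\<exists>y. z = (of_int a, y) \<and> of_int b \<le> y \<and> y \<le> of_int b + 1"
      by (intro exI[of _ "of_int b + u"]) (auto simp: algebra_simps)
  next
    assume "\<exists>y. z = (of_int a, y) \<and> of_int b \<le> y \<and> y \<le> of_int b + 1"
    then obtain y where "z = (of_int a, y)" "of_int b \<le> y" "y \<le> of_int b + 1" by blast
    then show "z \<in> unit_seg Ver (a, b)"
      by (auto simp: closed_segment_def algebra_simps intro!: exI[of _ "y - of_int b"])
  qed
qed

text \<open>The candidates avoid the midpoint of a horizontal segment, so no point has weight 2 and
  goodness is an exclusive or. In this form a simultaneous interchange of light and dark is
  harmless.\<close>

lemma good_two_points:
  assumes lp: "\<And>z. z \<in> light_points p q A c \<longleftrightarrow> z = z1 \<and> L1 \<or> z = z2 \<and> L2"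
    and ne: "z1 \<noteq> z2" and m: "A = Hor \<Longrightarrow> z1 \<noteq> seg_center A c \<and> z2 \<noteq> seg_center A c"
  shows "good p q A c \<longleftrightarrow> L1 \<noteq> L2"
proof -
  have "light_points p q A c = (if L1 then {z1} else {}) \<union> (if L2 then {z2} else {})"
    using lp by auto
  then show ?thesis using ne m unfolding good_def light_count_def
    by (auto simp: card_insert_if)
qed

lemma odd_sum_of_coprime:
  fixes a b :: int
  assumes "coprime a b" "even (a * b)"
  shows "odd (a + b)"
  using assms by (metis coprime_common_divisor even_add even_mult_iff odd_one)

lemma even_param_pos:
  assumes "even_param p q"
  shows "0 < p" "p < q" "odd (p + q)" "coprime (p + q) (2 * p)"
proof -
  show "0 < p" "p < q" using assms unfolding even_param_def by auto
  have "coprime p q" "even (p * q)" using assms unfolding even_param_def by auto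
  then show o: "odd (p + q)" by (rule odd_sum_of_coprime)
  have "coprime (p + q) p" using assms unfolding even_param_def
    by (simp add: coprime_commute coprime_iff_gcd_eq_1)
  then show "coprime (p + q) (2 * p)" using o by (simp add: coprime_commute)
qed

text \<open>On a vertical unit segment there is exactly one point of a slope \<open>-P\<close> line and one of a slope
  \<open>-Q\<close> line. As \<open>P + Q = 2\<close>, both intercepts are determined by \<open>f = \<lfloor>P a\<rfloor>\<close>.\<close>

lemma good_Ver:
  assumes ep: "even_param p q" and a: "0 \<le> a" "2 * a < p + q"
  defines "w \<equiv> p + q" and "f \<equiv> (2 * p * a) div (p + q)"
  shows "good p q Ver (a, b) \<longleftrightarrow>
    lit w (4 * p * a) (2 * p * (b + 1 + f) + w) \<noteq> lit w (4 * p * a) (2 * p * (b + 2 * a - f) + w)"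
proof (cases "a = 0")
  case True
  have w: "p + q > 0" using even_param_pos[OF ep] by auto
  have "\<not> lit w (4 * p * a) m" for m
    unfolding lit_def using True smod_zero[OF w] by (simp add: w_def)
  moreover have "light_points p q Ver (a, b) = {}"
    unfolding light_points_def unit_seg_mem using light_Ver[OF w] calculation[unfolded w_def] by blast
  ultimately show ?thesis by (simp add: good_def light_count_def)
next
  case False
  note e = even_param_pos[OF ep]
  have w: "p + q > 0" using e by auto
  define s :: real where "s = of_int ((2 * p * a) mod w) / of_int w"
  have Pa: "slopeP p q * of_int a = of_int f + s"
  proof -
    have "2 * p * a = w * f + (2 * p * a) mod w" unfolding f_def w_def by simp
    then have "(of_int (2 * p * a) :: real) = of_int w * of_int f + of_int ((2 * p * a) mod w)"
      by (metis of_int_add of_int_mult)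
    then show ?thesis unfolding slopeP_def s_def using w by (simp add: w_def field_simps)
  qed
  have PQ: "slopeP p q + slopeQ p q = 2" by (rule slope_sum[OF w])
  have "(2 * p * a) mod w \<noteq> 0"
  proof
    assume "(2 * p * a) mod w = 0"
    then have "w dvd 2 * p * a" by auto
    then have "w dvd a" using e(4) unfolding w_def by (metis coprime_dvd_mult_right_iff)
    then show False using a False zdvd_imp_le[of w a] unfolding w_def by linarith
  qed
  then have m0: "0 < (2 * p * a) mod w" "(2 * p * a) mod w < w"
    using pos_mod_sign[of w "2 * p * a"] pos_mod_bound[of w "2 * p * a"] w unfolding w_def by linarith+
  then have s: "0 < s" "s < 1" unfolding s_def by auto
  \<comment> \<open>The two candidate points are symmetric about the midpoint of the segment and
    would coincide only for \<open>s = 1 / 2\<close>; this is excluded because \<open>w\<close> is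
    odd.\<close>
  have s2: "s \<noteq> 1 / 2"
  proof
    assume "s = 1 / 2"
    then have "of_int (2 * ((2 * p * a) mod w)) = (of_int w :: real)"
      unfolding s_def using m0 by (simp add: field_simps)
    then have "2 * ((2 * p * a) mod w) = w" by (simp only: of_int_eq_iff)
    then show False using e(3) unfolding w_def by (metis dvd_triv_left)
  qed
  let ?z1 = "(of_int a, of_int b + 1 - s) :: real \<times> real" and ?z2 = "(of_int a, of_int b + s) :: real \<times> real"
  have P: "of_int b \<le> - slopeP p q * of_int a + of_int n \<and> - slopeP p q * of_int a + of_int n \<le> of_int b + 1
     \<longleftrightarrow> n = b + 1 + f" for n
    using Pa s by (auto; linarith)
  have Qa: "slopeQ p q * of_int a = 2 * of_int a - of_int f - s"
    using Pa PQ by (metis add_diff_cancel_left' diff_diff_eq distrib_right)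
  have Q: "of_int b \<le> - slopeQ p q * of_int a + of_int n \<and> - slopeQ p q * of_int a + of_int n \<le> of_int b + 1
     \<longleftrightarrow> n = b + 2 * a - f" for n
    using Qa s by (auto; linarith)
  show ?thesis
  proof (rule good_two_points)
    show "?z1 \<noteq> ?z2" using s2 by auto
    fix z
    show "z \<in> light_points p q Ver (a, b) \<longleftrightarrow> z = ?z1 \<and> lit w (4 * p * a) (2 * p * (b + 1 + f) + w)
      \<or> z = ?z2 \<and> lit w (4 * p * a) (2 * p * (b + 2 * a - f) + w)" (is "?L = ?R")
    proof -
      have "?L \<longleftrightarrow> (\<exists>B y n. z = (of_int a, y) \<and> of_int b \<le> y \<and> y \<le> of_int b + 1 \<and>
          y = slanted_slope p q B * of_int a + of_int n \<and> lit w (4 * p * a) (2 * p * n + w))"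
        unfolding light_points_def unit_seg_mem w_def mem_Collect_eq using light_Ver[OF w, of _ a] by blast
      also have "\<dots> \<longleftrightarrow> (\<exists>B n. z = (of_int a, slanted_slope p q B * of_int a + of_int n) \<and>
          of_int b \<le> slanted_slope p q B * of_int a + of_int n \<and> slanted_slope p q B * of_int a + of_int n \<le> of_int b + 1 \<and>
           lit w (4 * p * a) (2 * p * n + w))" by blast
      also have "\<dots> \<longleftrightarrow> (\<exists>n. z = (of_int a, - slopeP p q * of_int a + of_int n) \<and> n = b + 1 + f \<and>
            lit w (4 * p * a) (2 * p * n + w)) \<or>
          (\<exists>n. z = (of_int a, - slopeQ p q * of_int a + of_int n) \<and> n = b + 2 * a - f \<and>
            lit w (4 * p * a) (2 * p * n + w))"
        unfolding P[symmetric] Q[symmetric] ex_slanted slanted_slope.simps by blast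
      also have "\<dots> \<longleftrightarrow> ?R"
      proof -
        have 1: "of_int b + 1 - s = - slopeP p q * of_int a + of_int (b + 1 + f)" using Pa by simp
        have 2: "of_int b + s = - slopeQ p q * of_int a + of_int (b + 2 * a - f)" using Qa by simp
        show ?thesis unfolding 1 2 by blast
      qed
      finally show ?thesis .
    qed
  qed simp
qed

text \<open>A horizontal unit segment also carries exactly two points of slanted lines: one of each slope
  if \<open>\<lfloor>P x\<rfloor>\<close> jumps along it, and two of slope \<open>-Q\<close> otherwise. For \<open>a = 0\<close> the first of them is the
  common point of a line of each slope.\<close>

lemma good_Hor:
  assumes ep: "even_param p q" and a: "0 \<le> a" "2 * (a + 1) < p + q"
  defines "w \<equiv> p + q" and "f \<equiv> (2 * p * a) div (p + q)" and "g \<equiv> (2 * p * (a + 1)) div (p + q)"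
  shows "good p q Hor (a, b) \<longleftrightarrow>
    lit w (4 * p * b) (2 * p * (b + 2 * a - f) + w) \<noteq>
    lit w (4 * p * b) (2 * p * (if g = f + 1 then b + f + 1 else b + 2 * a - f + 1) + w)"
proof -
  note e = even_param_pos[OF ep]
  have w: "p + q > 0" using e by auto
  define P where "P = slopeP p q"
  define Q where "Q = slopeQ p q"
  have PQ: "P + Q = 2" unfolding P_def Q_def by (rule slope_sum[OF w])
  have P1: "0 < P" "P < 1" unfolding P_def slopeP_def using e by (auto simp: field_simps)
  have Q1: "1 < Q" "Q < 2" using P1 PQ by linarith+
  have fl: "of_int ((2 * p * c) div (p + q)) \<le> P * of_int c" "P * of_int c < of_int ((2 * p * c) div (p + q)) + 1" for c
  proof -
    have "P * of_int c = of_int (2 * p * c) / of_int (p + q)" unfolding P_def slopeP_def by simp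
    then have "(2 * p * c) div (p + q) = \<lfloor>P * of_int c\<rfloor>" by (simp only: floor_divide_of_int_eq)
    then show "of_int ((2 * p * c) div (p + q)) \<le> P * of_int c" "P * of_int c < of_int ((2 * p * c) div (p + q)) + 1"
      by linarith+
  qed
  have fs: "of_int ((2 * p * c) div (p + q)) < P * of_int c" if c: "0 < c" "c < p + q" for c
  proof -
    have "of_int ((2 * p * c) div (p + q)) \<noteq> P * of_int c"
    proof
      assume "of_int ((2 * p * c) div (p + q)) = P * of_int c"
      then have "2 * p * c = (2 * p * c) div (p + q) * (p + q)"
        unfolding P_def by (intro slopeP_int_eq[OF w]) simp
      then have "p + q dvd 2 * p * c" by (metis dvd_triv_right)
      then have "p + q dvd c" using e(4) by (metis coprime_dvd_mult_right_iff)
      then show False using c zdvd_imp_le[of "p + q" c] by linarith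
    qed
    then show ?thesis using fl(1)[of c] by linarith
  qed
  have Pa1: "P * of_int (a + 1) = P * of_int a + P" by (simp add: algebra_simps)
  have Qa: "Q * of_int a = 2 * of_int a - P * of_int a"
    by (metis PQ add_diff_cancel_left' distrib_right)
  have Qa1: "Q * of_int (a + 1) = Q * of_int a + Q" by (simp add: algebra_simps)
  have f: "of_int f \<le> P * of_int a" "P * of_int a < of_int f + 1" using fl[of a] unfolding f_def by auto
  have g: "of_int g < P * of_int a + P" "P * of_int a + P < of_int g + 1"
    using fs[of "a + 1"] fl(2)[of "a + 1"] a unfolding g_def Pa1 by auto
  have gf: "g = f \<or> g = f + 1"
  proof -
    have "of_int f < (of_int g + 1 :: real)" "of_int g < (of_int f + 2 :: real)" using f g P1 by linarith+
    then have "f < g + 1" "g < f + 2" by linarith+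
    then show ?thesis by linarith
  qed
  have fa: "a > 0 \<Longrightarrow> of_int f < P * of_int a" using fs[of a] a unfolding f_def by simp
  have f0: "a = 0 \<Longrightarrow> f = 0" unfolding f_def by simp
  have g0: "a = 0 \<Longrightarrow> g = 0" using e unfolding g_def by simp
  define x1 where "x1 = of_int (2 * a - f) / Q"
  define x2 where "x2 = (if g = f + 1 then of_int (f + 1) / P else of_int (2 * a - f + 1) / Q)"
  have x1: "Q * x1 = of_int (2 * a - f)" unfolding x1_def using Q1 by simp
  have x2: "g = f + 1 \<Longrightarrow> P * x2 = of_int (f + 1)" "g \<noteq> f + 1 \<Longrightarrow> Q * x2 = of_int (2 * a - f + 1)"
    unfolding x2_def using P1 Q1 by simp_all
  \<comment> \<open>As \<open>P + Q = 2\<close>, such an \<open>x\<close> would make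
    \<open>2 * x\<close> an integer, with \<open>w\<close> dividing \<open>2 * p * (2 * x)\<close>
    and hence \<open>2 * x\<close> itself, which lies strictly between \<open>0\<close> and
    \<open>w\<close>.\<close>
  have no: "\<not> (Q * x = of_int r \<and> P * x = of_int r')" if "0 < 2 * x" "2 * x < of_int (p + q)" for x r r'
  proof
    assume *: "Q * x = of_int r \<and> P * x = of_int r'"
    then have "2 * x = of_int (r + r')" using PQ by (metis add.commute distrib_right of_int_add)
    moreover have "P * (2 * x) = of_int (2 * r')" using * by simp
    ultimately have "P * of_int (r + r') = of_int (2 * r')" by metis
    then have "2 * p * (r + r') = 2 * r' * (p + q)" unfolding P_def by (rule slopeP_int_eq[OF w])
    then have "p + q dvd 2 * p * (r + r')" by (metis dvd_triv_right)
    then have "p + q dvd r + r'" using e(4) by (metis coprime_dvd_mult_right_iff)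
    moreover have "0 < r + r'" "r + r' < p + q"
      using that \<open>2 * x = of_int (r + r')\<close> by (simp_all only: of_int_0_less_iff of_int_less_iff)
    ultimately show False using zdvd_imp_le[of "p + q" "r + r'"] by linarith
  qed
  have ineqP: "P * of_int a \<le> P * x" "P * x \<le> P * of_int a + P" if "of_int a \<le> x" "x \<le> of_int a + 1" for x
    using that P1 mult_left_mono[of "of_int a" x P] mult_left_mono[of x "of_int a + 1" P]
    by (auto simp: algebra_simps)
  have ineqQ: "Q * of_int a \<le> Q * x" "Q * x \<le> Q * of_int a + Q" if "of_int a \<le> x" "x \<le> of_int a + 1" for x
    using that Q1 mult_left_mono[of "of_int a" x Q] mult_left_mono[of x "of_int a + 1" Q]
    by (auto simp: algebra_simps)
  have inQ: "of_int a \<le> x \<and> x \<le> of_int a + 1" if "Q * of_int a \<le> Q * x" "Q * x \<le> Q * of_int a + Q" for x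
  proof -
    have "Q * x \<le> Q * (of_int a + 1)" using that by (simp add: algebra_simps)
    then show ?thesis using that Q1 by simp
  qed
  have inP: "of_int a \<le> x \<and> x \<le> of_int a + 1" if "P * of_int a \<le> P * x" "P * x \<le> P * of_int a + P" for x
  proof -
    have "P * x \<le> P * (of_int a + 1)" using that by (simp add: algebra_simps)
    then show ?thesis using that P1 by simp
  qed
  have in1: "of_int a \<le> x1 \<and> x1 \<le> of_int a + 1"
    by (rule inQ) (use x1 Qa f g gf PQ P1 in auto)
  have in2: "of_int a \<le> x2 \<and> x2 \<le> of_int a + 1"
  proof (cases "g = f + 1")
    case True
    show ?thesis by (rule inP) (use x2(1)[OF True] True f g in auto)
  next
    case False
    then have "g = f" using gf by simp
    then show ?thesis by (intro inQ) (use x2(2)[OF False] f g Qa PQ in auto)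
  qed
  have ne: "x1 \<noteq> x2"
  proof (cases "g = f + 1")
    case True
    then have "a > 0" using a g0 f0 by force
    moreover have "of_int (2 * (a + 1)) < (of_int (p + q) :: real)" using a(2) by (simp only: of_int_less_iff)
    ultimately have "0 < 2 * x1" "2 * x1 < of_int (p + q)" using in1 by auto
    then show ?thesis using no[of x1] x1 x2(1)[OF True] by blast
  next
    case False
    then show ?thesis using x1 x2(2) by auto
  qed
  \<comment> \<open>At the midpoint \<open>P * x + Q * x\<close> is the integer
    \<open>2 * a + 1\<close>, so one integral product would make both integral.\<close>
  have cen: "\<not> (Q * x = of_int r) \<and> \<not> (P * x = of_int r)" if x: "x = of_int a + 1 / 2" for x r
  proof -
    have *: "Q * x + P * x = of_int (2 * a + 1)" unfolding x using PQ
      by (metis add.commute distrib_left distrib_right field_sum_of_halves mult.commute mult_2 of_int_1 of_int_add of_int_mult of_int_numeral)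
    have "of_int (2 * (a + 1)) < (of_int (p + q) :: real)" using a(2) by (simp only: of_int_less_iff)
    then have b: "0 < 2 * x" "2 * x < of_int (p + q)" using x a by auto
    show ?thesis using no[OF b, of r "2 * a + 1 - r"] no[OF b, of "2 * a + 1 - r" r] * by auto
  qed
  have candQ: "r = 2 * a - f \<or> (g \<noteq> f + 1 \<and> r = 2 * a - f + 1)"
    if "of_int a \<le> x" "x \<le> of_int a + 1" "Q * x = of_int r" for x r
  proof (cases "g = f + 1")
    case True
    have "of_int (2 * a - f) - 1 < (of_int r :: real)" "of_int r < (of_int (2 * a - f) + 1 :: real)"
      using ineqQ[OF that(1,2)] that(3) Qa f g True PQ by (simp_all)
    then show ?thesis by linarith
  next
    case False
    then have "g = f" using gf by simp
    then have "of_int (2 * a - f) - 1 < (of_int r :: real)" "of_int r < (of_int (2 * a - f) + 2 :: real)"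
      using ineqQ[OF that(1,2)] that(3) Qa f g PQ by (simp_all)
    then show ?thesis using False by linarith
  qed
  have candP: "(a = 0 \<and> x = 0 \<and> r = 0) \<or> (g = f + 1 \<and> r = f + 1)"
    if "of_int a \<le> x" "x \<le> of_int a + 1" "P * x = of_int r" for x r
  proof (cases "a = 0")
    case True
    then have "of_int r < (1 :: real)" "of_int r \<ge> (0 :: real)"
      using ineqP[OF that(1,2)] that(3) P1 by auto
    then have "r = 0" by linarith
    then show ?thesis using True that(3) P1 by simp
  next
    case False
    then have "of_int f < (of_int r :: real)" "of_int r < (of_int g + 1 :: real)"
      using ineqP[OF that(1,2)] that(3) fa g a by auto
    then have "f < r" "r < g + 1" by linarith+
    then show ?thesis using gf by linarith
  qed
  let ?l = "\<lambda>n. lit w (4 * p * b) (2 * p * n + w)"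
  let ?z1 = "(x1, of_int b) :: real \<times> real" and ?z2 = "(x2, of_int b) :: real \<times> real"
  define n2 where "n2 = (if g = f + 1 then b + f + 1 else b + 2 * a - f + 1)"
  show ?thesis unfolding n2_def[symmetric]
  proof (rule good_two_points)
    show "?z1 \<noteq> ?z2" using ne by auto
    show "?z1 \<noteq> seg_center Hor (a, b) \<and> ?z2 \<noteq> seg_center Hor (a, b)"
    proof -
      have "x1 \<noteq> of_int a + 1 / 2" using cen[of x1] x1 by metis
      moreover have "x2 \<noteq> of_int a + 1 / 2" using cen[of x2] x2 by metis
      ultimately show ?thesis by simp
    qed
    fix z
    have sl: "of_int b = - S * x + of_int n \<longleftrightarrow> S * x = of_int (n - b)" for S x :: real and n
      by auto
    have "z \<in> light_points p q Hor (a, b) \<longleftrightarrow> (\<exists>B x n. z = (x, of_int b) \<and> of_int a \<le> x \<and> x \<le> of_int a + 1 \<and>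
        of_int b = slanted_slope p q B * x + of_int n \<and> ?l n)"
      unfolding light_points_def unit_seg_mem w_def mem_Collect_eq using light_Hor[OF w, of _ _ b] by blast
    also have "\<dots> \<longleftrightarrow> (\<exists>x n. z = (x, of_int b) \<and> of_int a \<le> x \<and> x \<le> of_int a + 1 \<and>
        (P * x = of_int (n - b) \<or> Q * x = of_int (n - b)) \<and> ?l n)"
      unfolding sl[symmetric] P_def Q_def ex_slanted slanted_slope.simps by blast
    also have "\<dots> \<longleftrightarrow> z = ?z1 \<and> ?l (b + 2 * a - f) \<or> z = ?z2 \<and> ?l n2" (is "?L = ?R")
    proof
      assume ?L
      then obtain x n where z: "z = (x, of_int b)" and x: "of_int a \<le> x" "x \<le> of_int a + 1"
        and n: "P * x = of_int (n - b) \<or> Q * x = of_int (n - b)" and l: "?l n" by blast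
      have Qc: ?R if "Q * x = of_int (n - b)"
      proof (cases "n - b = 2 * a - f")
        case True
        then have "x = x1" using that Q1 unfolding x1_def by (simp add: field_simps)
        moreover have "n = b + 2 * a - f" using True by simp
        ultimately show ?thesis using l z by simp
      next
        case False
        then have gg: "g \<noteq> f + 1" and nn: "n - b = 2 * a - f + 1" using candQ[OF x that] by blast+
        then have "x = x2" using that Q1 unfolding x2_def by (simp add: field_simps)
        moreover have "n = n2" using nn gg by (simp add: n2_def)
        ultimately show ?thesis using l z by simp
      qed
      from n show ?R
      proof
        assume Px: "P * x = of_int (n - b)"
        from candP[OF x this] show ?R
        proof
          assume "a = 0 \<and> x = 0 \<and> n - b = 0"
          then have "Q * x = of_int (n - b)" by simp
          then show ?R by (rule Qc)
        next
          assume *: "g = f + 1 \<and> n - b = f + 1"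
          then have "x = x2" using Px P1 unfolding x2_def by (simp add: field_simps)
          moreover have "n = n2" using * by (simp add: n2_def)
          ultimately show ?R using l z by simp
        qed
      qed (rule Qc)
    next
      assume ?R
      then show ?L
      proof
        assume "z = ?z1 \<and> ?l (b + 2 * a - f)"
        then show ?L using in1 x1 by (intro exI[of _ x1] exI[of _ "b + 2 * a - f"]) auto
      next
        assume "z = ?z2 \<and> ?l n2"
        then show ?L using in2 x2 by (intro exI[of _ x2] exI[of _ "n2"]) (auto simp: n2_def)
      qed
    qed
    finally show "z \<in> light_points p q Hor (a, b) \<longleftrightarrow> z = ?z1 \<and> ?l (b + 2 * a - f) \<or> z = ?z2 \<and> ?l n2" .
  qed
qed

section \<open>The parameter and its core predecessor\<close>

text \<open>Multiplying \<open>M\<close> by \<open>p\<close> gives \<open>e * k\<close> modulo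
  \<open>w\<close>, since \<open>p * w1\<close> is \<open>e\<close> modulo \<open>w\<close>. The
  remaining term is \<open>w * (k * p1 + p + 1)\<close>, where \<open>p\<close> comes from measuring
  from the middle of the block and \<open>1\<close> from the constant in the slanted functions; the
  parities of \<open>k\<close> and \<open>p + p1\<close> make it a multiple of
  \<open>2 * w\<close>.\<close>

lemma mass_res:
  fixes p w :: int
  assumes "p * w1 = p1 * w + e" "odd k" "odd (p + p1)" "2 * m = M + w" "M = k * w1 + 2 * w * j"
  obtains z where "2 * p * m + w = e * k + 2 * w * z"
proof -
  have "even (k * p1 + p + 1)" using assms(2,3) by auto
  then obtain y where y: "k * p1 + p + 1 = 2 * y" by (elim evenE)
  have "2 * p * m + w = p * (2 * m) + w" by simp
  also have "\<dots> = k * (p * w1) + 2 * w * (p * j) + (p + 1) * w"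
    unfolding assms(4,5) by (simp add: algebra_simps)
  also have "\<dots> = e * k + w * (k * p1 + p + 1) + 2 * w * (p * j)"
    unfolding assms(1) by (simp add: algebra_simps)
  also have "\<dots> = e * k + 2 * w * (y + p * j)" unfolding y by (simp add: algebra_simps)
  finally show ?thesis by (rule that)
qed

lemma cap_res_Hor:
  fixes p w :: int
  assumes "p * w1 = p1 * w + e" "2 * b = B + w" "B = l * w1 + w * i"
  shows "4 * p * b = e * (2 * l) + 2 * w * (l * p1 + p * i + p)"
proof -
  have "4 * p * b = 2 * p * (2 * b)" by simp
  also have "\<dots> = 2 * l * (p * w1) + 2 * w * (p * i) + 2 * w * p"
    unfolding assms(2,3) by (simp add: algebra_simps)
  finally show ?thesis unfolding assms(1) by (simp add: algebra_simps)
qed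

lemma cap_res_Ver:
  fixes p w :: int
  assumes "p * w1 = p1 * w + e" "2 * a = l * w1 + w * i"
  shows "4 * p * a = e * (2 * l) + 2 * w * (l * p1 + p * i)"
proof -
  have "4 * p * a = 2 * p * (2 * a)" by simp
  also have "\<dots> = 2 * l * (p * w1) + 2 * w * (p * i)"
    unfolding assms(2) by (simp add: algebra_simps)
  finally show ?thesis unfolding assms(1) by (simp add: algebra_simps)
qed

lemma div_add_small:
  fixes w r t :: int
  assumes "\<bar>r\<bar> < w" shows "(w * t + r) div w = t + (if r < 0 then - 1 else 0)"
proof (cases "r < 0")
  case True
  then have "(w * t + r) div w = (w * (t - 1) + (w + r)) div w" by (simp add: algebra_simps)
  also have "\<dots> = t - 1" using True assms by (subst div_mult_self4) auto
  finally show ?thesis using True by simp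
next
  case False
  then show ?thesis using assms by auto
qed

text \<open>\<open>p1\<close>/\<open>q1\<close> stands for the even predecessor,
  \<open>ph\<close>/\<open>qh\<close> for the core predecessor and \<open>n\<close> for \<kappa>;
  \<open>t\<close> is the abscissa of the right side. The tune survives in the bounds
  \<open>w1 < wh\<close> and \<open>wh < 3 * w1\<close>. The parity of \<open>p + p1\<close> lifts
  congruences modulo \<open>w\<close> to congruences modulo \<open>2 * w\<close>.\<close>

locale core =
  fixes p q p1 q1 ph qh n e w w1 wh h t :: int
  assumes w_def: "w = p + q" and w1_def: "w1 = p1 + q1" and wh_def: "wh = ph + qh"
    and ep: "even_param p q" and eh: "even_param ph qh"
    and ph: "ph = p - 2 * n * p1" and qh: "qh = q - 2 * n * q1"
    and n_ge: "n \<ge> 1" and e_cases: "e = 1 \<or> e = -1"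
    and rel: "p * w1 = p1 * w + e"
    and h_def: "w1 = 2 * h - 1" and t_def: "2 * t = wh - w1" and w1_ge3: "w1 \<ge> 3" and odd_pp1: "odd (p + p1)"
    and w1_less: "w1 < wh" and wh_less: "wh < 3 * w1"
begin

lemma odd_w1: "odd w1" unfolding h_def by simp

lemma w_eq: "w = wh + 2 * n * w1"
  unfolding w_def w1_def wh_def ph qh by (simp add: algebra_simps)

lemma relh: "ph * w1 = p1 * wh + e"
proof -
  have "ph * w1 = p * w1 - p1 * (2 * n * w1)" unfolding ph by (simp add: algebra_simps)
  also have "\<dots> = p1 * wh + e" unfolding rel w_eq by (simp add: algebra_simps)
  finally show ?thesis .
qed

lemma odd_php1: "odd (ph + p1)"
  using odd_pp1 unfolding ph by auto

lemma odd_wh: "odd wh" unfolding wh_def by (rule even_param_pos(3)[OF eh])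

sublocale core_arith w w1 wh n e h
proof
qed (use h_def w_eq n_ge e_cases w1_ge3 odd_wh w1_less wh_less in auto)

section \<open>Coordinates of intercepts and grid lines with respect to \<open>w1\<close> and
  \<open>wh\<close>\<close>

lemma mass_rep:
  assumes "odd M"
  obtains k j where "odd k" "\<bar>k\<bar> \<le> wh" "M = k * w1 + 2 * wh * j"
proof -
  have ee: "e * e = 1" using e_cases by auto
  have ev: "even (e * p1 * M + w1 * (e * ph + 1))"
    using e_cases odd_w1 odd_php1 assms by auto
  then obtain y where y: "e * p1 * M + w1 * (e * ph + 1) = 2 * y" by (elim evenE)
  \<comment> \<open>\<open>e * ph\<close> inverts \<open>w1\<close> modulo \<open>wh\<close>. The
    added multiple of \<open>wh\<close> makes \<open>k0\<close> odd, and then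
    \<open>M - k0 * w1\<close> is divisible by \<open>2 * wh\<close> and not just by
    \<open>wh\<close>.\<close>
  define k0 where "k0 = e * ph * M + wh * (e * ph + 1)"
  have "k0 * w1 = e * (ph * w1) * M + wh * w1 * (e * ph + 1)" unfolding k0_def by (simp add: algebra_simps)
  also have "\<dots> = e * e * M + wh * (e * p1 * M + w1 * (e * ph + 1))" unfolding relh by (simp add: algebra_simps)
  also have "\<dots> = M + 2 * wh * y" unfolding y ee by (simp add: algebra_simps)
  finally have k0: "M = k0 * w1 + 2 * wh * (- y)" by simp
  have ok: "odd k0" unfolding k0_def using odd_wh e_cases assms by auto
  obtain z where z: "k0 = smod wh k0 + 2 * wh * z" by (rule smod_exists)
  have "M = smod wh k0 * w1 + 2 * wh * (z * w1 - y)" using k0 by (subst (asm) z) (simp add: algebra_simps)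
  moreover have "odd (smod wh k0)" using ok odd_smod[OF odd_wh] by blast
  moreover have "\<bar>smod wh k0\<bar> \<le> wh" using smod_range[of wh k0] wh_gt w1_ge by linarith
  ultimately show ?thesis using that by blast
qed

lemma cap_rep:
  obtains l i where "2 * \<bar>l\<bar> \<le> wh - 1" "B = l * w1 + wh * i"
proof -
  have ee: "e * e = 1" using e_cases by auto
  obtain c where c: "wh = 2 * c + 1" using odd_wh by (elim oddE)
  define l where "l = (e * ph * B + c) mod wh - c"
  define z where "z = (e * ph * B + c) div wh"
  have lz: "e * ph * B = l + wh * z" unfolding l_def z_def by (simp add: minus_mult_div_eq_mod[symmetric])
  have l_eq: "l = e * ph * B - wh * z" using lz by simp
  have "l * w1 = e * (ph * w1) * B - wh * z * w1" unfolding l_eq by (simp add: algebra_simps)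
  also have "\<dots> = e * e * B + wh * (e * p1 * B - z * w1)" unfolding relh by (simp add: algebra_simps)
  finally have "B = l * w1 + wh * (z * w1 - e * p1 * B)" unfolding ee by (simp add: algebra_simps)
  moreover have "2 * \<bar>l\<bar> \<le> wh - 1"
  proof -
    have "wh > 0" using wh_gt w1_ge by linarith
    from pos_mod_sign[OF this] pos_mod_bound[OF this]
    have "0 \<le> (e * ph * B + c) mod wh" "(e * ph * B + c) mod wh < wh" by blast+
    moreover have "2 * \<bar>x - c\<bar> \<le> wh - 1" if "0 \<le> x" "x < wh" for x using that unfolding c by (cases "x \<ge> c") auto
    ultimately show ?thesis unfolding l_def by blast
  qed
  ultimately show ?thesis using that by blast
qed

lemma mass_both:
  assumes "2 * m = M + wh" "M = k * w1 + 2 * wh * j" "odd k"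
  shows "lit wh c (2 * ph * m + wh) = lit wh c (e * k)"
    "lit w c' (2 * p * (m + n * w1) + w) = lit w c' (e * (k - 4 * n * j))"
proof -
  obtain z where "2 * ph * m + wh = e * k + 2 * wh * z" by (rule mass_res[OF relh assms(3) odd_php1 assms(1,2)])
  then show "lit wh c (2 * ph * m + wh) = lit wh c (e * k)" by (intro lit_cong[where y = 0]) auto
  have "odd (k - 4 * n * j)" using assms(3) by simp
  moreover have "2 * (m + n * w1) = M + w" using assms(1) w_eq by (simp add: algebra_simps)
  moreover have "M = (k - 4 * n * j) * w1 + 2 * w * j" unfolding assms(2) w_eq by (simp add: algebra_simps)
  ultimately obtain z where "2 * p * (m + n * w1) + w = e * (k - 4 * n * j) + 2 * w * z"
    using mass_res[OF rel _ odd_pp1] by blast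
  then show "lit w c' (2 * p * (m + n * w1) + w) = lit w c' (e * (k - 4 * n * j))" by (intro lit_cong[where y = 0]) auto
qed

lemma odd_mass: "odd (2 * m - wh)" using odd_wh by simp

text \<open>If \<open>\<bar>i\<bar> \<ge> h\<close>, then \<open>2 * a\<close> is negative or
  \<open>4 * a \<ge> wh + w1\<close>, while \<open>4 * a \<le> 2 * (wh - w1) < wh + w1\<close> by
  \<open>wh < 3 * w1\<close>. Thus no vertical line of the rectangle has a value that passes through
  \<plusminus>1, and light and dark are never interchanged on it.\<close>

lemma Ver_rep:
  assumes "0 \<le> a" "2 * a \<le> wh - w1"
  obtains v i where "2 * \<bar>v\<bar> \<le> wh - 1" "2 * a = v * w1 + wh * i" "\<bar>i\<bar> \<le> h - 1" "v > 0 \<longrightarrow> i \<le> 0"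
    "v < 0 \<longrightarrow> i \<ge> 0" "v = 0 \<longrightarrow> i = 0"
proof -
  obtain v i where v: "2 * \<bar>v\<bar> \<le> wh - 1" and a: "2 * a = v * w1 + wh * i" by (rule cap_rep)
  have b: "\<bar>2 * a\<bar> < w1 + wh" "0 < w1" "0 < wh" using assms w1_ge wh_gt by auto
  note s = opposite_signs[OF a b]
  have s0: "i = 0" if "v = 0"
  proof -
    have "wh * i = 2 * a" using a that by simp
    then have "wh * (- 1) < wh * i" "wh * i < wh * 1" using assms w1_ge wh_gt by linarith+
    then have "i > - 1" "i < 1" using b(3) mult_less_cancel_left_pos by blast+
    then show ?thesis by linarith
  qed
  have "\<not> \<bar>i\<bar> \<ge> h"
  proof
    assume i: "\<bar>i\<bar> \<ge> h"
    then have "v \<noteq> 0" using s0 w1 w1_ge by auto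
    have m: "2 * (wh * h) = wh * w1 + wh" unfolding w1 by (simp add: algebra_simps)
    have "2 * \<bar>v\<bar> * w1 \<le> (wh - 1) * w1" using v w1_ge by (intro mult_right_mono) auto
    then have l: "2 * (\<bar>v\<bar> * w1) \<le> wh * w1 - w1" by (simp add: left_diff_distrib)
    have ii: "wh * h \<le> wh * \<bar>i\<bar>" using i b by (intro mult_left_mono) auto
    show False
    proof (cases "v > 0")
      case True
      then have "2 * a = \<bar>v\<bar> * w1 - wh * \<bar>i\<bar>" using a s(1) by simp
      then show False using l ii m assms w1_ge wh_gt by linarith
    next
      case False
      then have "2 * a = wh * \<bar>i\<bar> - \<bar>v\<bar> * w1" using a s(2) \<open>v \<noteq> 0\<close> by simp
      then have "4 * a \<ge> wh + w1" using l ii m by linarith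
      then show False using assms wh_lt by linarith
    qed
  qed
  then have "\<bar>i\<bar> \<le> h - 1" by linarith
  with v a s s0 show ?thesis using that by blast
qed

lemma lit_Ver:
  assumes a: "0 \<le> a" "2 * a \<le> wh - w1"
    and m: "\<bar>2 * m - wh\<bar> < 2 * wh + w1" "\<bar>4 * a - (2 * m - wh)\<bar> < 2 * wh + w1"
  shows "lit w (4 * p * a) (2 * p * (m + n * w1) + w) = lit wh (4 * ph * a) (2 * ph * m + wh)"
proof -
  obtain v i where v: "2 * \<bar>v\<bar> \<le> wh - 1" and B: "2 * a = v * w1 + wh * i" and i: "\<bar>i\<bar> \<le> h - 1"
    by (rule Ver_rep[OF a])
  obtain k j where k: "odd k" "\<bar>k\<bar> \<le> wh" and M: "2 * m - wh = k * w1 + 2 * wh * j" by (rule mass_rep[OF odd_mass])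
  have B': "2 * a = (v - 2 * n * i) * w1 + w * i" unfolding B w_eq by (simp add: algebra_simps)
  note mb = mass_both[OF _ M k(1)]
  have "lit wh (4 * ph * a) (e * k) = lit wh (e * (2 * v)) (e * k)"
    by (rule lit_cong[where z = 0, OF cap_res_Ver[OF relh B]]) simp
  moreover have "lit w (4 * p * a) (e * (k - 4 * n * j)) = lit w (e * (2 * (v - 2 * n * i))) (e * (k - 4 * n * j))"
    by (rule lit_cong[where z = 0, OF cap_res_Ver[OF rel B']]) simp
  moreover have "lit w (e * (2 * (v - 2 * n * i))) (e * (k - 4 * n * j)) \<longleftrightarrow> lit wh (e * (2 * v)) (e * k)"
    by (rule lit_normal[OF M m(1) k B _ v i]) (use m(2) in simp)
  ultimately show ?thesis using mb by simp
qed

lemma not_lit_zero_cap: "\<not> lit wh (2 * wh * c) m"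
proof -
  have "smod wh (2 * wh * c) = 0" using smod_cong[of wh 0 c] smod_zero[of wh] wh_gt w1_ge by simp
  then show ?thesis unfolding lit_def by auto
qed

text \<open>Between the two parameters the light points on a horizontal line either stay the same or are
  all interchanged with the dark ones; the latter happens on at most two lines.\<close>

lemma lit_Hor:
  assumes b: "0 \<le> b" "b \<le> wh"
  obtains flip where "\<forall>r. 0 \<le> r \<and> r \<le> wh - w1 - 1 \<longrightarrow>
    (lit w (4 * p * (b + n * w1)) (2 * p * (b + r + n * w1) + w) \<longleftrightarrow> lit wh (4 * ph * b) (2 * ph * (b + r) + wh) \<noteq> flip)"
proof -
  define B where "B = 2 * b - wh"
  have Bb: "\<bar>B\<bar> \<le> wh" "2 * b = B + wh" "2 * (b + n * w1) = B + w" using b w_eq unfolding B_def by (auto simp: algebra_simps)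
  obtain l i where l: "2 * \<bar>l\<bar> \<le> wh - 1" and Bl: "B = l * w1 + wh * i" by (rule cap_rep)
  have Bl': "B = (l - 2 * n * i) * w1 + w * i" unfolding Bl w_eq by (simp add: algebra_simps)
  have b1: "\<bar>B\<bar> < w1 + wh" "0 < w1" "0 < wh" using Bb w1_ge wh_gt by auto
  note s = opposite_signs[OF Bl b1]
  have ch: "lit wh (4 * ph * b) m = lit wh (e * (2 * l)) m" for m
    by (rule lit_cong[where z = 0, OF cap_res_Hor[OF relh Bb(2) Bl]]) simp
  have cw: "lit w (4 * p * (b + n * w1)) m = lit w (e * (2 * (l - 2 * n * i))) m" for m
    by (rule lit_cong[where z = 0, OF cap_res_Hor[OF rel Bb(3) Bl']]) simp
  note goalI = that
  have red: thesis if *: "\<And>k j r M. 0 \<le> r \<Longrightarrow> 2 * r \<le> 2 * wh - 2 * w1 - 2 \<Longrightarrow> M = B + 2 * r \<Longrightarrow> M = k * w1 + 2 * wh * j \<Longrightarrow>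
      odd k \<Longrightarrow> \<bar>k\<bar> \<le> wh \<Longrightarrow> \<bar>M\<bar> < 2 * wh + w1 \<Longrightarrow> \<bar>2 * B - M\<bar> < 2 * wh + w1 \<Longrightarrow>
      lit w (e * (2 * (l - 2 * n * i))) (e * (k - 4 * n * j)) \<longleftrightarrow> lit wh (e * (2 * l)) (e * k) \<noteq> flip" for flip
  proof (rule goalI, intro allI impI, elim conjE)
    fix r assume r: "0 \<le> r" "r \<le> wh - w1 - 1"
    obtain k j where k: "odd k" "\<bar>k\<bar> \<le> wh" and M: "2 * (b + r) - wh = k * w1 + 2 * wh * j"
      by (rule mass_rep[OF odd_mass])
    have M2: "2 * (b + r) - wh = B + 2 * r" unfolding B_def by simp
    note mb = mass_both[OF _ M k(1)]
    have "lit w (e * (2 * (l - 2 * n * i))) (e * (k - 4 * n * j)) \<longleftrightarrow> lit wh (e * (2 * l)) (e * k) \<noteq> flip"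
      by (rule *[OF r(1) _ M2 M k]) (use r Bb(1) M2 w1_ge wh_lt in linarith)+
    then show "lit w (4 * p * (b + n * w1)) (2 * p * (b + r + n * w1) + w) \<longleftrightarrow>
      lit wh (4 * ph * b) (2 * ph * (b + r) + wh) \<noteq> flip"
      unfolding ch cw using mb by simp
  qed
  have m: "2 * (wh * h) = wh * w1 + wh" unfolding w1 by (simp add: algebra_simps)
  have "2 * \<bar>l\<bar> * w1 \<le> (wh - 1) * w1" using l w1_ge by (intro mult_right_mono) auto
  then have lw: "2 * (\<bar>l\<bar> * w1) \<le> wh * w1 - w1" by (simp add: left_diff_distrib)
  \<comment> \<open>Since \<open>\<bar>B\<bar> \<le> wh\<close>, the condition
    \<open>\<bar>i\<bar> \<ge> h\<close> leaves at most the two lines at distance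
    \<open>(wh + w1) / 4\<close> from the middle of the block.\<close>
  have bad: "2 * \<bar>l\<bar> = wh - 1 \<and> \<bar>i\<bar> = h \<and> 2 * \<bar>B\<bar> = wh + w1 \<and> (l > 0 \<longrightarrow> B < 0 \<and> i < 0) \<and> (l < 0 \<longrightarrow> B > 0 \<and> i > 0)"
    if i: "\<bar>i\<bar> \<ge> h" and l0: "l \<noteq> 0"
  proof -
    have aB: "\<bar>B\<bar> = wh * \<bar>i\<bar> - \<bar>l\<bar> * w1 \<and> (l > 0 \<longrightarrow> B < 0 \<and> i < 0) \<and> (l < 0 \<longrightarrow> B > 0 \<and> i > 0)"
    proof -
      have ge: "wh * \<bar>i\<bar> > \<bar>l\<bar> * w1"
      proof -
        have "wh * h \<le> wh * \<bar>i\<bar>" using i b1 by (intro mult_left_mono) auto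
        then show ?thesis using lw m w1_ge wh_gt by linarith
      qed
      show ?thesis
      proof (cases "l > 0")
        case True
        then have "i \<le> 0" "i \<noteq> 0" using s(1) i w1 w1_ge by auto
        then show ?thesis using True ge Bl by auto
      next
        case False
        then have "l < 0" using l0 by simp
        then have "i \<ge> 0" "i \<noteq> 0" using s(2) i w1 w1_ge by auto
        then show ?thesis using \<open>l < 0\<close> ge Bl by auto
      qed
    qed
    have ih: "\<bar>i\<bar> = h"
    proof (rule ccontr)
      assume "\<bar>i\<bar> \<noteq> h"
      then have "wh * (h + 1) \<le> wh * \<bar>i\<bar>" using i b1 by (intro mult_left_mono) auto
      then have "wh * h + wh \<le> wh * \<bar>i\<bar>" by (simp add: distrib_left)
      moreover have "\<bar>B\<bar> = wh * \<bar>i\<bar> - \<bar>l\<bar> * w1" using aB by blast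
      ultimately have "2 * \<bar>B\<bar> > 2 * wh" using lw m w1_ge wh_gt by linarith
      then show False using Bb by simp
    qed
    have ll: "2 * \<bar>l\<bar> = wh - 1"
    proof (rule ccontr)
      assume "2 * \<bar>l\<bar> \<noteq> wh - 1"
      then have "2 * \<bar>l\<bar> \<le> wh - 3" using l odd_wh by presburger
      then have "2 * \<bar>l\<bar> * w1 \<le> (wh - 3) * w1" using w1_ge by (intro mult_right_mono) auto
      then have "2 * (\<bar>l\<bar> * w1) \<le> wh * w1 - 3 * w1" by (simp add: left_diff_distrib)
      moreover have "\<bar>B\<bar> = wh * h - \<bar>l\<bar> * w1" using aB ih by simp
      ultimately have "2 * \<bar>B\<bar> > 2 * wh" using m w1_ge wh_lt by linarith
      then show False using Bb by simp
    qed
    have "2 * \<bar>B\<bar> = 2 * (wh * h) - 2 * \<bar>l\<bar> * w1" using aB ih by simp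
    then have "2 * \<bar>B\<bar> = wh + w1" unfolding m ll by (simp add: algebra_simps)
    then show ?thesis using ih ll aB by blast
  qed
  have e': "- e = 1 \<or> - e = -1" using e_cases by auto
  \<comment> \<open>\<open>l = 0\<close> with \<open>i \<noteq> 0\<close> means \<open>i = 1\<close>
    or \<open>i = -1\<close>, the top and the bottom of the block, where the value is zero for
    \<open>wh\<close> only. The last two cases are the lines on which light and dark are
    interchanged.\<close>
  consider "\<bar>i\<bar> \<le> h - 1" "l \<noteq> 0 \<or> i = 0" | "l = 0" "i \<noteq> 0" | "l < 0" "\<bar>i\<bar> \<ge> h" | "l > 0" "\<bar>i\<bar> \<ge> h"
    using w1 w1_ge by linarith
  then show thesis
  proof cases
    case 1
    show thesis
      by (rule red[of False]) (use lit_normal[OF _ _ _ _ Bl _ l 1(1)] in blast)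
  next
    case 2
    have "\<bar>wh * i\<bar> \<le> wh * 1" using Bb Bl 2 by simp
    then have "\<bar>i\<bar> \<le> 1" using b1(3) by (simp add: abs_mult)
    then have "i = 1 \<or> i = -1" using 2 by linarith
    then show thesis
    proof
      assume i: "i = 1"
      show thesis
      proof (rule red[of False])
        fix k j r M assume r: "0 \<le> r" "M = B + 2 * r" and M: "M = k * w1 + 2 * wh * j" "\<bar>M\<bar> < 2 * wh + w1" and k: "odd k" "\<bar>k\<bar> \<le> wh"
        have "M > - w1" using r Bl 2 i w1_ge wh_gt by simp
        from not_lit_zero_line[OF e_cases M k this]
        show "lit w (e * (2 * (l - 2 * n * i))) (e * (k - 4 * n * j)) \<longleftrightarrow> lit wh (e * (2 * l)) (e * k) \<noteq> False"
          using not_lit_zero_cap[of 0] 2 i by simp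
      qed
    next
      assume i: "i = - 1"
      show thesis
      proof (rule red[of False])
        fix k j r M assume r: "0 \<le> r" "2 * r \<le> 2 * wh - 2 * w1 - 2" "M = B + 2 * r" and M: "M = k * w1 + 2 * wh * j" "\<bar>M\<bar> < 2 * wh + w1" and k: "odd k" "\<bar>k\<bar> \<le> wh"
        have "- M = (- k) * w1 + 2 * wh * (- j)" "\<bar>- M\<bar> < 2 * wh + w1" "odd (- k)" "\<bar>- k\<bar> \<le> wh" using M k by auto
        note * = not_lit_zero_line[OF e' this]
        have "- M > - w1" using r Bl 2 i wh_lt by simp
        from *[OF this]
        show "lit w (e * (2 * (l - 2 * n * i))) (e * (k - 4 * n * j)) \<longleftrightarrow> lit wh (e * (2 * l)) (e * k) \<noteq> False"
          using not_lit_zero_cap[of 0] 2 i by (simp add: algebra_simps)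
      qed
    qed
  next
    case 3
    have bd: "2 * l = - (wh - 1)" "i = h" "2 * B = wh + w1" using bad 3 w1 w1_ge by auto
    show thesis
    proof (rule red[of True])
      fix k j r M assume r: "0 \<le> r" "2 * r \<le> 2 * wh - 2 * w1 - 2" "M = B + 2 * r" and M: "M = k * w1 + 2 * wh * j" "\<bar>M\<bar> < 2 * wh + w1" and k: "odd k" "\<bar>k\<bar> \<le> wh"
      have "- wh < M" using r bd w1_ge wh_gt by linarith
      then show "lit w (e * (2 * (l - 2 * n * i))) (e * (k - 4 * n * j)) \<longleftrightarrow> lit wh (e * (2 * l)) (e * k) \<noteq> True"
        using lit_flip[OF e_cases M(1) _ _ k bd(1)] M(2) unfolding bd(2) by auto
    qed
  next
    case 4
    have bd: "2 * (- l) = - (wh - 1)" "i = - h" "2 * B = - (wh + w1)" using bad 4 w1 w1_ge by auto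
    show thesis
    proof (rule red[of True])
      fix k j r M assume r: "0 \<le> r" "2 * r \<le> 2 * wh - 2 * w1 - 2" "M = B + 2 * r" and M: "M = k * w1 + 2 * wh * j" "\<bar>M\<bar> < 2 * wh + w1" and k: "odd k" "\<bar>k\<bar> \<le> wh"
      have "- wh < - M" "- M < 2 * wh + w1" using r bd w1_ge wh_lt M by linarith+
      moreover have "- M = (- k) * w1 + 2 * wh * (- j)" "odd (- k)" "\<bar>- k\<bar> \<le> wh" using M k by auto
      ultimately have "lit w (- e * (2 * (- l - 2 * n * h))) (- e * (- k - 4 * n * - j)) \<longleftrightarrow> \<not> lit wh (- e * (2 * - l)) (- e * - k)"
        using lit_flip[OF e' _ _ _ _ _ bd(1)] by blast
      then show "lit w (e * (2 * (l - 2 * n * i))) (e * (k - 4 * n * j)) \<longleftrightarrow> lit wh (e * (2 * l)) (e * k) \<noteq> True"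
        unfolding bd(2) by (simp add: algebra_simps)
    qed
  qed
qed

text \<open>Both products are a multiple of the modulus plus a small remainder, \<open>V * e\<close>
  or \<open>v * e\<close>. The multipliers agree because \<open>ph = p - 2 * n * p1\<close>, and the
  remainders have the same sign. Hence the slanted lines that cross corresponding segments have
  intercepts that differ exactly by the translation \<open>n * w1\<close>.\<close>

lemma floor_eq:
  assumes a: "0 \<le> a" "2 * a \<le> wh - w1"
  shows "(2 * p * a) div w = (2 * ph * a) div wh"
proof -
  obtain v i where v: "2 * \<bar>v\<bar> \<le> wh - 1" and B: "2 * a = v * w1 + wh * i" and i: "\<bar>i\<bar> \<le> h - 1"
    and s: "v > 0 \<longrightarrow> i \<le> 0" "v < 0 \<longrightarrow> i \<ge> 0" "v = 0 \<longrightarrow> i = 0"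
    by (rule Ver_rep[OF a])
  define V where "V = v - 2 * n * i"
  have B': "2 * a = V * w1 + w * i" unfolding B V_def w_eq by (simp add: algebra_simps)
  have Vb: "\<bar>V\<bar> < w" using cap_bound[OF v i, folded V_def] n by linarith
  have ni: "v > 0 \<Longrightarrow> n * i \<le> 0" "v < 0 \<Longrightarrow> n * i \<ge> 0" using s n by (auto simp: mult_le_0_iff)
  have sg: "V * e < 0 \<longleftrightarrow> v * e < 0"
  proof -
    have "(V < 0) = (v < 0)" "(V > 0) = (v > 0)"
      using ni s(3) unfolding V_def mult.assoc by (cases "v = 0"; cases "v > 0"; simp)+
    then show ?thesis using e_cases by auto
  qed
  have "2 * ph * a = ph * (2 * a)" by simp
  also have "\<dots> = v * (ph * w1) + wh * (ph * i)" unfolding B by (simp add: algebra_simps)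
  finally have "2 * ph * a = v * (ph * w1) + wh * (ph * i)" .
  then have 1: "2 * ph * a = wh * (v * p1 + ph * i) + v * e" unfolding relh by (simp add: algebra_simps)
  have "2 * p * a = p * (2 * a)" by simp
  also have "\<dots> = V * (p * w1) + w * (p * i)" unfolding B' by (simp add: algebra_simps)
  finally have "2 * p * a = V * (p * w1) + w * (p * i)" .
  then have 2: "2 * p * a = w * (V * p1 + p * i) + V * e" unfolding rel by (simp add: algebra_simps)
  have 3: "V * p1 + p * i = v * p1 + ph * i" unfolding V_def ph by (simp add: algebra_simps)
  have "\<bar>V * e\<bar> < w" "\<bar>v * e\<bar> < wh" using Vb v e_cases by auto
  then show ?thesis unfolding 1 2 3 using sg by (simp only: div_add_small)
qed

lemma floor_bounds:
  assumes "0 \<le> a" shows "0 \<le> (2 * ph * a) div wh" "(2 * ph * a) div wh \<le> a"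
proof -
  have e: "0 < ph" "ph < qh" using even_param_pos[OF eh] by auto
  then show "0 \<le> (2 * ph * a) div wh" unfolding wh_def using assms by (simp add: pos_imp_zdiv_nonneg_iff)
  have "2 * ph * a \<le> wh * a" unfolding wh_def using e assms by (intro mult_right_mono) auto
  then have "(2 * ph * a) div wh \<le> (wh * a) div wh" unfolding wh_def using e by (intro zdiv_mono1) auto
  then show "(2 * ph * a) div wh \<le> a" unfolding wh_def using e by simp
qed

section \<open>Transfer of goodness between the core predecessor and the parameter\<close>

lemma good_Ver_shift:
  assumes a: "0 \<le> a" "2 * a \<le> wh - w1" and b: "0 \<le> b" "b < wh"
  shows "good p q Ver (a, b + n * w1) \<longleftrightarrow> good ph qh Ver (a, b)"
proof -
  define f where "f = (2 * ph * a) div wh"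
  have f: "0 \<le> f" "f \<le> a" "(2 * p * a) div w = f"
    unfolding f_def by (fact floor_bounds[OF a(1)] floor_eq[OF a])+
  have wle: "wh \<le> w" using w_eq n w1_ge by simp
  have g1: "good ph qh Ver (a, b) \<longleftrightarrow>
    lit wh (4 * ph * a) (2 * ph * (b + 1 + f) + wh) \<noteq> lit wh (4 * ph * a) (2 * ph * (b + 2 * a - f) + wh)"
    unfolding f_def wh_def by (rule good_Ver[OF eh a(1)]) (use a w1_ge wh_def in linarith)
  have g2: "good p q Ver (a, b + n * w1) \<longleftrightarrow>
    lit w (4 * p * a) (2 * p * (b + n * w1 + 1 + f) + w) \<noteq> lit w (4 * p * a) (2 * p * (b + n * w1 + 2 * a - f) + w)"
    unfolding f(3)[symmetric] w_def by (rule good_Ver[OF ep a(1)]) (use a w1_ge wle w_def in linarith)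
  have r: "b + n * w1 + 1 + f = (b + 1 + f) + n * w1" "b + n * w1 + 2 * a - f = (b + 2 * a - f) + n * w1" by simp_all
  have bnd: "b + 1 \<le> wh" "2 * f \<le> wh - w1" "0 < w1" "0 < wh" using a b f(1,2) w1_ge wh_gt by auto
  have 1: "lit w (4 * p * a) (2 * p * ((b + 1 + f) + n * w1) + w) = lit wh (4 * ph * a) (2 * ph * (b + 1 + f) + wh)"
  proof (rule lit_Ver[OF a]; unfold abs_less_iff; intro conjI)
    have m: "2 * (b + 1 + f) - wh = 2 * b + 2 + 2 * f - wh" by simp
    show "2 * (b + 1 + f) - wh < 2 * wh + w1" unfolding m using bnd(1-3) by linarith
    show "- (2 * (b + 1 + f) - wh) < 2 * wh + w1" unfolding m using bnd(3,4) b(1) f(1) by linarith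
    show "4 * a - (2 * (b + 1 + f) - wh) < 2 * wh + w1" unfolding m using a(2) b(1) f(1) wh_lt by linarith
    show "- (4 * a - (2 * (b + 1 + f) - wh)) < 2 * wh + w1" unfolding m using bnd(1,3,4) a(1) f(2) by linarith
  qed
  have 2: "lit w (4 * p * a) (2 * p * ((b + 2 * a - f) + n * w1) + w) = lit wh (4 * ph * a) (2 * ph * (b + 2 * a - f) + wh)"
  proof (rule lit_Ver[OF a]; unfold abs_less_iff; intro conjI)
    have m: "2 * (b + 2 * a - f) - wh = 2 * b + 4 * a - 2 * f - wh" by simp
    show "2 * (b + 2 * a - f) - wh < 2 * wh + w1" unfolding m using bnd(1) a(2) f(1) wh_lt by linarith
    show "- (2 * (b + 2 * a - f) - wh) < 2 * wh + w1" unfolding m using bnd(3,4) b(1) a(1) f(2) by linarith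
    show "4 * a - (2 * (b + 2 * a - f) - wh) < 2 * wh + w1" unfolding m using bnd(2,3) b(1) by linarith
    show "- (4 * a - (2 * (b + 2 * a - f) - wh)) < 2 * wh + w1" unfolding m using bnd(1,3,4) f(1) by linarith
  qed
  show ?thesis using g1 g2[unfolded r] 1 2 by argo
qed

lemma good_Hor_shift:
  assumes a: "0 \<le> a" "2 * (a + 1) \<le> wh - w1" and b: "0 \<le> b" "b \<le> wh"
  shows "good p q Hor (a, b + n * w1) \<longleftrightarrow> good ph qh Hor (a, b)"
proof -
  define f where "f = (2 * ph * a) div wh"
  define g where "g = (2 * ph * (a + 1)) div wh"
  have a2: "2 * a \<le> wh - w1" "0 \<le> a + 1" using a by simp_all
  have f: "0 \<le> f" "f \<le> a" "(2 * p * a) div w = f"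
    unfolding f_def by (fact floor_bounds[OF a(1)] floor_eq[OF a(1) a2(1)])+
  have g: "(2 * p * (a + 1)) div w = g" unfolding g_def by (rule floor_eq[OF a2(2) a(2)])
  have wle: "wh \<le> w" using w_eq n w1_ge by simp
  define r2 where "r2 = (if g = f + 1 then f + 1 else 2 * a - f + 1)"
  have r2: "(if g = f + 1 then c + f + 1 else c + 2 * a - f + 1) = c + r2" for c unfolding r2_def by simp
  have g1: "good ph qh Hor (a, b) \<longleftrightarrow>
    lit wh (4 * ph * b) (2 * ph * (b + (2 * a - f)) + wh) \<noteq> lit wh (4 * ph * b) (2 * ph * (b + r2) + wh)"
  proof -
    have r: "b + 2 * a - f = b + (2 * a - f)" by simp
    have "2 * (a + 1) < wh" using a(2) w1_ge by linarith
    from good_Hor[OF eh a(1) this[unfolded wh_def], of b, folded wh_def, folded f_def g_def, unfolded r2, unfolded r]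
    show ?thesis .
  qed
  have g2: "good p q Hor (a, b + n * w1) \<longleftrightarrow>
    lit w (4 * p * (b + n * w1)) (2 * p * (b + (2 * a - f) + n * w1) + w) \<noteq> lit w (4 * p * (b + n * w1)) (2 * p * (b + r2 + n * w1) + w)"
  proof -
    have r: "b + n * w1 + 2 * a - f = b + (2 * a - f) + n * w1" "b + n * w1 + r2 = b + r2 + n * w1" by simp_all
    have "2 * (a + 1) < w" using a(2) w1_ge wle by linarith
    from good_Hor[OF ep a(1) this[unfolded w_def], of "b + n * w1", folded w_def, unfolded f(3) g, unfolded r2, unfolded r]
    show ?thesis .
  qed
  obtain flip where flip: "\<forall>r. 0 \<le> r \<and> r \<le> wh - w1 - 1 \<longrightarrow>
    (lit w (4 * p * (b + n * w1)) (2 * p * (b + r + n * w1) + w) \<longleftrightarrow> lit wh (4 * ph * b) (2 * ph * (b + r) + wh) \<noteq> flip)"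
    by (rule lit_Hor[OF b])
  \<comment> \<open>Both intercepts exceed \<open>b\<close> by at most \<open>2 * a + 1\<close>, and
    \<open>2 * (a + 1) \<le> wh - w1\<close>; this is the origin of the range of \<open>r\<close> in
    \<open>lit_Hor\<close>.\<close>
  have "0 \<le> 2 * a - f" "2 * a - f \<le> wh - w1 - 1" "0 \<le> r2" "r2 \<le> wh - w1 - 1"
    using a2 a f(1,2) unfolding r2_def by (cases "g = f + 1"; simp)+
  then have "lit w (4 * p * (b + n * w1)) (2 * p * (b + (2 * a - f) + n * w1) + w) \<longleftrightarrow>
      lit wh (4 * ph * b) (2 * ph * (b + (2 * a - f)) + wh) \<noteq> flip"
    "lit w (4 * p * (b + n * w1)) (2 * p * (b + r2 + n * w1) + w) \<longleftrightarrow> lit wh (4 * ph * b) (2 * ph * (b + r2) + wh) \<noteq> flip"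
    using flip by blast+
  then show ?thesis unfolding g1 g2 by blast
qed

lemma not_good_boundary:
  assumes a: "0 \<le> a" "2 * (a + 1) \<le> wh - w1" and b: "b = 0 \<or> b = wh"
  shows "\<not> good ph qh Hor (a, b)"
proof -
  have "4 * ph * b = 2 * wh * (if b = 0 then 0 else 2 * ph)" using b by (elim disjE) simp_all
  then have "\<not> lit wh (4 * ph * b) m" for m by (simp only: not_lit_zero_cap not_False_eq_True)
  moreover have "2 * (a + 1) < wh" using a(2) w1_ge by linarith
  ultimately show ?thesis using good_Hor[OF eh a(1), of b, folded wh_def] by blast
qed

text \<open>In \<open>2 * c = v * w1 + wh * i\<close>, capacity at most 4 means
  \<open>\<bar>v\<bar> \<le> 2\<close>, and \<open>t\<close> is the case \<open>v = -1\<close>,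
  \<open>i = 1\<close>. The other small coefficients give a negative number, contradict the parity
  of \<open>w1\<close> or \<open>wh\<close>, or give a larger abscissa; for \<open>v = 2\<close>,
  \<open>i = 0\<close> the latter is \<open>w1 > t\<close>, by \<open>wh < 3 * w1\<close>.\<close>

lemma right_line_eq: "right_line ph qh = t"
proof -
  have whp: "wh > 0" using wh_gt w1_ge by linarith
  have cap: "v_capacity ph qh c = of_int \<bar>smod wh (4 * ph * c)\<bar>" for c
    unfolding v_capacity_def grid_fun_int[OF whp[unfolded wh_def]] using whp unfolding wh_def by simp
  have tcap: "\<bar>smod wh (4 * ph * t)\<bar> = 2"
  proof -
    have "2 * t = (- 1) * w1 + wh * 1" using t_def by simp
    from cap_res_Ver[OF relh this] have "smod wh (4 * ph * t) = smod wh (e * (2 * (- 1)))" by (rule smod_congI)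
    also have "\<dots> = e * (2 * (- 1))" using e_cases wh_gt w1_ge by (intro smod_id_abs) auto
    finally show ?thesis using e_cases by auto
  qed
  have t0: "0 \<le> t" "t \<le> wh" using t_def wh_gt w1_ge by auto
  show ?thesis unfolding right_line_def wh_def[symmetric]
  proof (rule Min_eqI)
    show "t \<in> {c \<in> {0..wh}. 0 < v_capacity ph qh c \<and> v_capacity ph qh c \<le> 4}"
    proof -
      have "v_capacity ph qh t = 2" unfolding cap tcap by simp
      then show ?thesis using t0 by simp
    qed
    fix c assume "c \<in> {c \<in> {0..wh}. 0 < v_capacity ph qh c \<and> v_capacity ph qh c \<le> 4}"
    then have c: "0 \<le> c" "0 < \<bar>smod wh (4 * ph * c)\<bar>" "\<bar>smod wh (4 * ph * c)\<bar> \<le> 4" unfolding cap by auto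
    show "t \<le> c"
    proof (rule ccontr)
      assume "\<not> t \<le> c"
      then have c2: "2 * c < wh - w1" using t_def by simp
      obtain v i where v: "2 * \<bar>v\<bar> \<le> wh - 1" and B: "2 * c = v * w1 + wh * i"
        and s: "v > 0 \<longrightarrow> i \<le> 0" "v < 0 \<longrightarrow> i \<ge> 0" by (rule Ver_rep[OF c(1)]) (use c2 in auto)
      have "smod wh (4 * ph * c) = smod wh (e * (2 * v))" using cap_res_Ver[OF relh B] by (rule smod_congI)
      also have "\<dots> = e * (2 * v)" using e_cases v by (intro smod_id_abs) auto
      finally have "0 < \<bar>v\<bar>" "\<bar>v\<bar> \<le> 2" using c e_cases by auto
      then consider "v = 1" | "v = 2" | "v = -1" | "v = -2" by linarith
      then show False
      proof cases
        case 1
        then have "i \<noteq> 0" using B odd_w1 by auto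
        then have "wh * i \<le> wh * (-1)" using s(1) 1 whp by (intro mult_left_mono) auto
        then show False using B 1 c wh_gt by simp
      next
        case 2
        show False
        proof (cases "i \<le> -2")
          case True
          then have "wh * i \<le> wh * (-2)" using whp by (intro mult_left_mono) auto
          then show False using B 2 c wh_gt by simp
        next
          case False
          then have "i = 0 \<or> i = -1" using s(1) 2 by linarith
          then show False
          proof
            assume "i = 0" then show False using B 2 c2 wh_lt by simp
          next
            assume "i = -1" then have "wh = 2 * (w1 - c)" using B 2 by simp
            then show False using odd_wh by (metis dvd_triv_left)
          qed
        qed
      next
        case 3
        then have "i \<noteq> 0" using B odd_w1 c w1_ge by auto
        then have "wh * 1 \<le> wh * i" using s(2) 3 whp by (intro mult_left_mono) auto
        then show False using B 3 c2 by simp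
      next
        case 4
        show False
        proof (cases "i \<ge> 2")
          case True
          then have "wh * 2 \<le> wh * i" using whp by (intro mult_left_mono) auto
          then show False using B 4 c2 wh_gt by simp
        next
          case False
          then have "i = 0 \<or> i = 1" using s(2) 4 by linarith
          then show False
          proof
            assume "i = 0" then show False using B 4 c w1_ge by simp
          next
            assume "i = 1" then have "wh = 2 * (w1 + c)" using B 4 by simp
            then show False using odd_wh by (metis dvd_triv_left)
          qed
        qed
      qed
    qed
  qed (rule finite_subset[of _ "{0..wh}"], auto)
qed

end

section \<open>Unit squares at the right side of the rectangle\<close>

text \<open>The right side has capacity 2, with value \<open>-2 e / w\<close>. For \<open>e = 1\<close> the slanted lines meeting a
  unit square to its left are one of slope \<open>-P\<close>, on both vertical edges, and three of slope \<open>-Q\<close> with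
  consecutive intercepts; the light point of a good right edge has \<open>w\<close>-fold value \<open>-1\<close> and lies on
  the first line or on the last of these three. For \<open>e = -1\<close> there are two lines of each slope, in
  symmetric position. Below \<open>P\<close> is the integer \<open>2 * ph\<close>, and \<open>h\<close> is the value of the bottom edge.\<close>

lemma square_parity_minus:
  fixes w P h :: int
  assumes "odd w" "even P" "0 < P" "P < w" "even h" "\<bar>h\<bar> < w" "h \<noteq> - P"
  shows "(of_bool (lit w (- 2 - 2 * P) (- 1) \<noteq> lit w (- 2 - 2 * P) (h - 1 - P))
    + of_bool (lit w h (h - 1 - P) \<noteq> lit w h (h - 1))
    + of_bool (lit w (h + 2 * P) (h - 1) \<noteq> lit w (h + 2 * P) (h - 1 + P))) = (1 :: nat)"
proof -
  have w: "w > 0" using assms by linarith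
  obtain w' P' h' where e: "w = 2 * w' + 1" "P = 2 * P'" "h = 2 * h'" using assms by (metis evenE oddE)
  note r = smod_if[OF w]
  have s: "smod w h = h"  "smod w (- 1) = - 1" "smod w (h - 1) = h - 1"
    using r[of h] r[of "-1"] r[of "h - 1"] assms(1-6) e by auto
  \<comment> \<open>Even numbers cannot hit the odd wrap point \<open>w\<close>. Every argument lies
    in \<open>[-3 * w, 3 * w)\<close>, so each wraps at most once, and every combination of wraps
    leaves linear comparisons with parity.\<close>
  have d: "2 + 2 * P < w \<or> 2 + 2 * P > w" "h + 2 * P < w \<or> h + 2 * P > w" using e by presburger+
  consider "2 + 2 * P < w" "smod w (- 2 - 2 * P) = - 2 - 2 * P" | "2 + 2 * P > w" "smod w (- 2 - 2 * P) = - 2 - 2 * P + 2 * w"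
    using r[of "- 2 - 2 * P"] assms(3,4) d(1) by (elim disjE) auto
  note c1 = this
  consider "P + 1 - h < w" "smod w (h - 1 - P) = h - 1 - P" | "P + 1 - h = w" "smod w (h - 1 - P) = h - 1 - P"
    | "P + 1 - h > w" "smod w (h - 1 - P) = h - 1 - P + 2 * w"
    using r[of "h - 1 - P"] assms(3-6) by (cases "P + 1 - h < w"; cases "P + 1 - h = w") auto
  note c2 = this
  consider "h - 1 + P < w" "smod w (h - 1 + P) = h - 1 + P" | "h - 1 + P \<ge> w" "smod w (h - 1 + P) = h - 1 + P - 2 * w"
    using r[of "h - 1 + P"] assms(3-6) by (cases "h - 1 + P < w") auto
  note c3 = this
  consider "h + 2 * P < w" "smod w (h + 2 * P) = h + 2 * P" | "h + 2 * P > w" "smod w (h + 2 * P) = h + 2 * P - 2 * w"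
    using r[of "h + 2 * P"] assms(3-6) d(2) by (elim disjE) auto
  note c4 = this
  show ?thesis unfolding lit_def s
    by (rule c1; rule c2; rule c3; rule c4) (insert assms(3,4,6,7) e, simp_all only: , (simp add: of_bool_def; (linarith | presburger))+)
qed

text \<open>Obtained from \<open>square_parity_minus\<close> by reflecting the square in a horizontal line, which
  replaces \<open>h\<close> by \<open>- h - 2 * P\<close>.\<close>

lemma square_parity_minus_reflected:
  fixes w P h :: int
  assumes "odd w" "even P" "0 < P" "P < w" "even h" "\<bar>h\<bar> < w" "h \<noteq> - P"
  shows "(of_bool (lit w (- 2 - 2 * P) (h - 1 + P) \<noteq> lit w (- 2 - 2 * P) (- 1 - 2 * P))
    + of_bool (lit w h (- 1 - 2 * P) \<noteq> lit w h (- 1 - P))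
    + of_bool (lit w (h + 2 * P) (- 1 - P) \<noteq> lit w (h + 2 * P) (- 1))) = (1 :: nat)"
proof -
  have w: "w > 0" using assms by linarith
  define g where "g = smod w (- h - 2 * P)"
  obtain z where z: "g = - h - 2 * P + 2 * w * z"
  proof -
    obtain y where "- h - 2 * P = g + 2 * w * y" unfolding g_def by (rule smod_exists)
    then show ?thesis by (intro that[of "- y"]) simp
  qed
  have g: "even g" using odd_smod[OF assms(1), of "- h - 2 * P"] assms unfolding g_def by auto
  then have gb: "\<bar>g\<bar> < w" using smod_range[OF w, of "- h - 2 * P"] assms(1) unfolding g_def[symmetric] by (cases "g = - w") auto
  have gP: "g \<noteq> - P"
  proof
    assume "g = - P"
    then have "2 * w * z = h + P" using z by simp
    moreover have "\<bar>h + P\<bar> < 2 * w" using assms by linarith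
    ultimately have "2 * w * z < 2 * w * 1" "2 * w * (- 1) < 2 * w * z" by linarith+
    moreover have "0 < 2 * w" using w by simp
    ultimately have "z < 1" "- 1 < z" using mult_less_cancel_left_pos by blast+
    then have "z = 0" by linarith
    then show False using z \<open>g = - P\<close> assms by simp
  qed
  have 1: "lit w (- 2 - 2 * P) (h - 1 + P) = lit w (- 2 - 2 * P) (g - 1 - P)"
    using lit_reflect[OF w, of "- 2 - 2 * P" "h - 1 + P"] lit_cong[of "- 2 - 2 * P" "- 2 - 2 * P" w 0 "g - 1 - P" "- 2 - 2 * P - (h - 1 + P)" z] z
    by simp
  have 2: "lit w (- 2 - 2 * P) (- 1 - 2 * P) = lit w (- 2 - 2 * P) (- 1)"
    using lit_reflect[OF w, of "- 2 - 2 * P" "- 1"] by simp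
  have B: "lit w h m = lit w (g + 2 * P) (m + g + 2 * P)" for m
    using lit_minus[OF w assms(1,5), of "h - m"] lit_reflect[OF w, of h m]
      lit_cong[of "g + 2 * P" "- h" w z "m + g + 2 * P" "- (h - m)" z] z by simp
  have T: "lit w (h + 2 * P) m = lit w g (g + m)" for m
    using lit_minus[OF w assms(1), of "h + 2 * P" "h + 2 * P - m"] lit_reflect[OF w, of "h + 2 * P" m]
      lit_cong[of g "- (h + 2 * P)" w z "g + m" "- (h + 2 * P - m)" z] z assms(5) by simp
  show ?thesis unfolding 1 2 B T using square_parity_minus[OF assms(1-4) g gb gP] by (simp add: algebra_simps eq_commute)
qed

text \<open>The case \<open>e = -1\<close>: the lines of one slope have values \<open>1 - P\<close>
  and \<open>1\<close>, those of the other slope \<open>h + 1\<close> and \<open>h + 1 + P\<close>.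
  The right edge meets the lines with values \<open>1\<close> and \<open>h + 1 + P\<close>;
  \<open>h \<noteq> - P\<close> says that the second point is not light as well.\<close>

lemma square_parity_plus:
  fixes w P h :: int
  assumes "odd w" "even P" "0 < P" "P < w" "even h" "\<bar>h\<bar> < w" "h \<noteq> - P"
  shows "(of_bool (lit w (2 - 2 * P) (1 - P) \<noteq> lit w (2 - 2 * P) (h + 1))
    + of_bool (lit w h (1 - P) \<noteq> lit w h (h + 1))
    + of_bool (lit w (h + 2 * P) 1 \<noteq> lit w (h + 2 * P) (h + 1 + P))) = (1 :: nat)"
proof -
  have w: "w > 0" using assms by linarith
  obtain w' P' h' where e: "w = 2 * w' + 1" "P = 2 * P'" "h = 2 * h'" using assms by (metis evenE oddE)
  note r = smod_if[OF w]
  have w3: "w \<ge> 3" using e(2) assms(3,4) by presburger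
  have s: "smod w h = h"  "smod w 1 = 1" "smod w (1 - P) = 1 - P"
    using r[of h] r[of 1] r[of "1 - P"] assms(3-6) w3 by auto
  have d: "2 * P < w + 2 \<or> 2 * P > w + 2" "h + 2 * P < w \<or> h + 2 * P > w" using e by presburger+
  consider "2 * P < w + 2" "smod w (2 - 2 * P) = 2 - 2 * P" | "2 * P > w + 2" "smod w (2 - 2 * P) = 2 - 2 * P + 2 * w"
    using r[of "2 - 2 * P"] assms(3,4) d(1) w3 by (elim disjE) auto
  note c1 = this
  consider "h + 1 < w" "smod w (h + 1) = h + 1" | "h + 1 = w" "smod w (h + 1) = - w"
    using r[of "h + 1"] smod_edge[OF w] assms(3-6) by (cases "h + 1 < w") auto
  note c2 = this
  consider "h + 1 + P < w" "smod w (h + 1 + P) = h + 1 + P" | "h + 1 + P \<ge> w" "smod w (h + 1 + P) = h + 1 + P - 2 * w"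
    using r[of "h + 1 + P"] assms(3-6) by (cases "h + 1 + P < w") auto
  note c3 = this
  consider "h + 2 * P < w" "smod w (h + 2 * P) = h + 2 * P" | "h + 2 * P > w" "smod w (h + 2 * P) = h + 2 * P - 2 * w"
    using r[of "h + 2 * P"] assms(3-6) d(2) by (elim disjE) auto
  note c4 = this
  show ?thesis unfolding lit_def s
    by (rule c1; rule c2; rule c3; rule c4) (insert assms(3,4,6,7) e, simp_all only: , (simp add: of_bool_def; (linarith | presburger))+)
qed

section \<open>Good edges of the square to the left of a good right edge\<close>

lemma lit_pm2:
  assumes "w \<ge> 3"
  shows "lit w (- 2) m \<longleftrightarrow> smod w m = - 1" "lit w 2 m \<longleftrightarrow> smod w m = 1"
  unfolding lit_def using smod_id_abs[of "- 2" w] smod_id_abs[of 2 w] assms by auto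

text \<open>\<open>A\<close> is the value on the slope \<open>-P\<close> line, and
  \<open>q1\<close>, \<open>q1 + P\<close>, \<open>q1 + 2 * P\<close> are those on the three slope
  \<open>-Q\<close> lines. \<open>sum\<close> expresses that for a square with lower left corner
  \<open>(a, b)\<close> the two intercepts on the left edge add up to
  \<open>2 * b + 2 * a + 1\<close>. With it, the bottom value and the position of the light point
  determine all other values.\<close>

lemma square_count_minus:
  fixes w P H A q1 :: int
  assumes w: "odd w" and P: "even P" "0 < P" "P < w" and H: "even H" and sum: "A + q1 = H - 2 - P + 2 * w * y"
    and right: "lit w (- 2) A \<noteq> lit w (- 2) (q1 + 2 * P)"
  shows "of_bool (lit w (- 2 - 2 * P) A \<noteq> lit w (- 2 - 2 * P) q1) + of_bool (lit w H q1 \<noteq> lit w H (q1 + P))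
    + of_bool (lit w (H + 2 * P) (q1 + P) \<noteq> lit w (H + 2 * P) (q1 + 2 * P)) = (1 :: nat)"
proof -
  have w3: "w \<ge> 3" using w P by presburger
  define g where "g = smod w H"
  obtain z where z: "H = g + 2 * w * z" unfolding g_def by (rule smod_exists)
  have g: "even g" using odd_smod[OF w, of H] H unfolding g_def by blast
  have "g \<noteq> - w" using g w by (metis even_minus)
  then have gb: "\<bar>g\<bar> < w" using smod_range[of w H] w3 unfolding g_def[symmetric] by linarith
  have Hl: "lit w H m = lit w g m" "lit w (H + 2 * P) m = lit w (g + 2 * P) m" for m
    by (rule lit_cong[where y = z and z = 0], use z in simp, simp)+
  have s1: "smod w (- 1) = - 1" using w3 by (intro smod_id_abs) auto
  consider "smod w A = - 1" "smod w (q1 + 2 * P) \<noteq> - 1" | "smod w A \<noteq> - 1" "smod w (q1 + 2 * P) = - 1"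
    using right unfolding lit_pm2[OF w3] by blast
  then show ?thesis
  proof cases
    case 1
    obtain y1 where y1: "A = - 1 + 2 * w * y1" using smod_exists[of A w] 1(1) by metis
    have q1: "q1 = g - 1 - P + 2 * w * (z + y - y1)" using sum z y1 by (simp add: algebra_simps)
    have l: "lit w c A = lit w c (- 1)" "lit w c q1 = lit w c (g - 1 - P)" "lit w c (q1 + P) = lit w c (g - 1)"
      "lit w c (q1 + 2 * P) = lit w c (g - 1 + P)" for c
      by (rule lit_cong[where y = 0 and z = y1] lit_cong[where y = 0 and z = "z + y - y1"]; use y1 q1 in simp)+
    \<comment> \<open>For \<open>g = - P\<close> the other point of the right edge would have value
      \<open>-1\<close> too, so both would be light, against \<open>right\<close>.\<close>
    have "g \<noteq> - P"
    proof
      assume "g = - P"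
      then have "q1 + 2 * P = - 1 + 2 * w * (z + y - y1)" using q1 by simp
      from smod_congI[OF this] s1 1(2) show False by simp
    qed
    from square_parity_minus[OF w P g gb this] show ?thesis unfolding Hl l .
  next
    case 2
    obtain y1 where y1: "q1 + 2 * P = - 1 + 2 * w * y1" using smod_exists[of "q1 + 2 * P" w] 2(2) by metis
    have A: "A = g - 1 + P + 2 * w * (z + y - y1)" using sum z y1 by (simp add: algebra_simps)
    have l: "lit w c A = lit w c (g - 1 + P)" "lit w c q1 = lit w c (- 1 - 2 * P)" "lit w c (q1 + P) = lit w c (- 1 - P)"
      "lit w c (q1 + 2 * P) = lit w c (- 1)" for c
      by (rule lit_cong[where y = 0 and z = y1] lit_cong[where y = 0 and z = "z + y - y1"]; use y1 A in simp)+
    have "g \<noteq> - P"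
    proof
      assume "g = - P"
      then have "A = - 1 + 2 * w * (z + y - y1)" using A by simp
      from smod_congI[OF this] s1 2(1) show False by simp
    qed
    from square_parity_minus_reflected[OF w P g gb this] show ?thesis unfolding Hl l .
  qed
qed

lemma square_count_plus_aux:
  fixes w P H A q1 :: int
  assumes w: "odd w" and P: "even P" "0 < P" "P < w" and H: "even H" and sum: "A + q1 = H + 2 - P + 2 * w * y"
    and right: "smod w (A + P) = 1" "smod w (q1 + P) \<noteq> 1"
  shows "of_bool (lit w (2 - 2 * P) A \<noteq> lit w (2 - 2 * P) q1) + of_bool (lit w H A \<noteq> lit w H q1)
    + of_bool (lit w (H + 2 * P) (A + P) \<noteq> lit w (H + 2 * P) (q1 + P)) = (1 :: nat)"
proof -
  have w3: "w \<ge> 3" using w P by presburger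
  define g where "g = smod w H"
  obtain z where z: "H = g + 2 * w * z" unfolding g_def by (rule smod_exists)
  have g: "even g" using odd_smod[OF w, of H] H unfolding g_def by blast
  have "g \<noteq> - w" using g w by (metis even_minus)
  then have gb: "\<bar>g\<bar> < w" using smod_range[of w H] w3 unfolding g_def[symmetric] by linarith
  have Hl: "lit w H m = lit w g m" "lit w (H + 2 * P) m = lit w (g + 2 * P) m" for m
    by (rule lit_cong[where y = z and z = 0], use z in simp, simp)+
  have s1: "smod w 1 = 1" using w3 by (intro smod_id_abs) auto
  obtain y1 where y1: "A + P = 1 + 2 * w * y1" using smod_exists[of "A + P" w] right(1) by metis
  have q1: "q1 = g + 1 + 2 * w * (z + y - y1)" using sum z y1 by (simp add: algebra_simps)
  have l: "lit w c A = lit w c (1 - P)" "lit w c q1 = lit w c (g + 1)" "lit w c (A + P) = lit w c 1"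
    "lit w c (q1 + P) = lit w c (g + 1 + P)" for c
    by (rule lit_cong[where y = 0 and z = y1] lit_cong[where y = 0 and z = "z + y - y1"]; use y1 q1 in simp)+
  have "g \<noteq> - P"
  proof
    assume "g = - P"
    then have "q1 + P = 1 + 2 * w * (z + y - y1)" using q1 by simp
    from smod_congI[OF this] s1 right(2) show False by simp
  qed
  from square_parity_plus[OF w P g gb this] show ?thesis unfolding Hl l .
qed

text \<open>\<open>sum\<close> and the three counts are symmetric in \<open>A\<close> and
  \<open>q1\<close>, so it suffices to treat the light point on one of the two lines.\<close>

lemma square_count_plus:
  fixes w P H A q1 :: int
  assumes w: "odd w" and P: "even P" "0 < P" "P < w" and H: "even H" and sum: "A + q1 = H + 2 - P + 2 * w * y"
    and right: "lit w 2 (A + P) \<noteq> lit w 2 (q1 + P)"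
  shows "of_bool (lit w (2 - 2 * P) A \<noteq> lit w (2 - 2 * P) q1) + of_bool (lit w H q1 \<noteq> lit w H A)
    + of_bool (lit w (H + 2 * P) (q1 + P) \<noteq> lit w (H + 2 * P) (A + P)) = (1 :: nat)"
proof -
  have w3: "w \<ge> 3" using w P by presburger
  have sum': "q1 + A = H + 2 - P + 2 * w * y" using sum by simp
  consider "smod w (A + P) = 1" "smod w (q1 + P) \<noteq> 1" | "smod w (q1 + P) = 1" "smod w (A + P) \<noteq> 1"
    using right unfolding lit_pm2[OF w3] by blast
  then show ?thesis
  proof cases
    case 1
    from square_count_plus_aux[OF w P H sum 1] show ?thesis by (simp only: eq_commute)
  next
    case 2
    from square_count_plus_aux[OF w P H sum' 2] show ?thesis by (simp only: eq_commute)
  qed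
qed

lemma card_good_edges:
  "card (good_edges p q (a, b)) = of_bool (good p q Hor (a, b)) + of_bool (good p q Hor (a, b + 1))
    + of_bool (good p q Ver (a, b)) + of_bool (good p q Ver (a + 1, b))"
proof -
  have "good_edges p q (a, b) = square_edges (a, b) \<inter> {x. good p q (fst x) (snd x)}"
    unfolding good_edges_def by auto
  moreover have "finite (square_edges (a, b))" unfolding square_edges_def by simp
  ultimately have "card (good_edges p q (a, b)) = (\<Sum>x\<in>square_edges (a, b). of_bool (good p q (fst x) (snd x)))"
    by (simp add: sum_of_bool_eq)
  then show ?thesis unfolding square_edges_def by simp
qed

context core begin

lemma square_two_good:
  assumes "good ph qh Ver (t, b)"
  shows "card (good_edges ph qh (t - 1, b)) = 2"
proof -
  define a where "a = t - 1"
  define c where "c = ph - p1"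
  define P where "P = 2 * ph"
  have whp: "wh > 0" using wh_gt w1_ge by linarith
  have t: "t = a + 1" unfolding a_def by simp
  have ta: "2 * a + 2 = wh - w1" using t_def t by simp
  then have a0: "0 \<le> a" "2 * a < wh" "0 \<le> a + 1" "2 * (a + 1) < wh" using wh_gt w1_ge by auto
  have P: "even P" "0 < P" "P < wh" using even_param_pos[OF eh] unfolding P_def wh_def by auto
  \<comment> \<open>The slope times \<open>t\<close> is \<open>c - e / wh\<close>: just below the
    integer \<open>c\<close> for \<open>e = 1\<close> and just above it for \<open>e = -1\<close>.
    The floor at \<open>t\<close> thus depends on \<open>e\<close>, which is the source of the two
    configurations of slanted lines; the floor at \<open>t - 1\<close> is \<open>c - 1\<close> in
    both.\<close>
  have pt: "2 * ph * (a + 1) = wh * c - e"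
  proof -
    have "2 * ph * (a + 1) = ph * (2 * a + 2)" by simp
    also have "\<dots> = ph * wh - ph * w1" unfolding ta by (simp add: algebra_simps)
    also have "\<dots> = wh * c - e" unfolding relh c_def by (simp add: algebra_simps)
    finally show ?thesis .
  qed
  have fa: "(2 * ph * a) div wh = c - 1"
  proof -
    have "2 * ph * a = wh * (c - 1) + (wh - e - P)" using pt unfolding P_def by (simp add: algebra_simps)
    moreover have "\<not> wh - e - P < 0" "\<bar>wh - e - P\<bar> < wh" using e_cases P by auto
    ultimately show ?thesis by (simp only: div_add_small if_False add_0_right)
  qed
  have ft: "(2 * ph * (a + 1)) div wh = (if e = 1 then c - 1 else c)"
  proof -
    have "2 * ph * (a + 1) = wh * c + (- e)" using pt by simp
    moreover have "\<bar>- e\<bar> < wh" using e_cases wh_gt w1_ge by auto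
    ultimately have "(2 * ph * (a + 1)) div wh = c + (if - e < 0 then - 1 else 0)" by (simp only: div_add_small)
    then show ?thesis using e_cases by auto
  qed
  have cr: "4 * ph * (a + 1) = - 2 * e + 2 * wh * c" using pt by simp
  have cl: "4 * ph * a = (- 2 * e - 2 * P) + 2 * wh * c" using cr unfolding P_def by (simp add: algebra_simps)
  define H where "H = 4 * ph * b"
  have H: "even H" unfolding H_def by simp
  have Ht: "4 * ph * (b + 1) = H + 2 * P" unfolding H_def P_def by (simp add: algebra_simps)
  have lr: "lit wh (4 * ph * (a + 1)) m = lit wh (- 2 * e) m" for m
    by (rule lit_cong[where z = 0, OF cr]) simp
  have ll: "lit wh (4 * ph * a) m = lit wh (- 2 * e - 2 * P) m" for m
    by (rule lit_cong[where z = 0, OF cl]) simp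
  define A where "A = 2 * ph * (b + c) + wh"
  define q1 where "q1 = 2 * ph * (b + 2 * a - c + 1) + wh"
  have sum: "A + q1 = H + (- 2 * e - 2 * P) + P + 2 * wh * (c + 1)"
  proof -
    have "A + q1 = 4 * ph * b + 4 * ph * a + 2 * ph + 2 * wh" unfolding A_def q1_def by (simp add: algebra_simps)
    then show ?thesis unfolding cl H_def P_def by (simp add: algebra_simps)
  qed
  note GV = good_Ver[OF eh a0(1) a0(2)[unfolded wh_def], of b, folded wh_def, unfolded fa ll]
  note GR = good_Ver[OF eh a0(3) a0(4)[unfolded wh_def], of b, folded wh_def, unfolded ft lr]
  note GB = good_Hor[OF eh a0(1) a0(4)[unfolded wh_def], of b, folded wh_def, unfolded fa ft, folded H_def]
  note GT = good_Hor[OF eh a0(1) a0(4)[unfolded wh_def], of "b + 1", folded wh_def, unfolded fa ft Ht]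
  have g: "good ph qh Ver (a + 1, b)" using assms t by simp
  have "of_bool (good ph qh Ver (a, b)) + of_bool (good ph qh Hor (a, b)) + of_bool (good ph qh Hor (a, b + 1)) = (1 :: nat)"
    using e_cases
  proof
    assume e: "e = 1"
    have m: "2 * ph * (b + 1 + (c - 1)) + wh = A" "2 * ph * (b + 2 * a - (c - 1)) + wh = q1"
      "2 * ph * (b + 2 * (a + 1) - (c - 1)) + wh = q1 + 2 * P" "2 * ph * (b + 2 * a - (c - 1) + 1) + wh = q1 + P"
      "2 * ph * (b + 1 + 2 * a - (c - 1)) + wh = q1 + P" "2 * ph * (b + 1 + 2 * a - (c - 1) + 1) + wh = q1 + 2 * P"
      unfolding A_def q1_def P_def by (simp_all add: algebra_simps)
    have ne: "(c - 1 = c - 1 + 1) = False" "(e = 1) = True" using e by auto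
    have sum': "A + q1 = H - 2 - P + 2 * wh * (c + 1)" using sum e by simp
    have right: "lit wh (- 2) A \<noteq> lit wh (- 2) (q1 + 2 * P)"
      using g GR[unfolded ne if_True m] e by simp
    have "good ph qh Ver (a, b) \<longleftrightarrow> lit wh (- 2 - 2 * P) A \<noteq> lit wh (- 2 - 2 * P) q1"
      using GV[unfolded m] e by simp
    moreover note GB[unfolded ne if_True if_False m] GT[unfolded ne if_True if_False m]
    ultimately show ?thesis using square_count_minus[OF odd_wh P H sum' right] by (simp only:)
  next
    assume e: "e = -1"
    have m: "2 * ph * (b + 1 + (c - 1)) + wh = A" "2 * ph * (b + 2 * a - (c - 1)) + wh = q1"
      "2 * ph * (b + 1 + c) + wh = A + P" "2 * ph * (b + 2 * (a + 1) - c) + wh = q1 + P"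
      "2 * ph * (b + (c - 1) + 1) + wh = A"
      "2 * ph * (b + 1 + 2 * a - (c - 1)) + wh = q1 + P" "2 * ph * (b + 1 + (c - 1) + 1) + wh = A + P"
      unfolding A_def q1_def P_def by (simp_all add: algebra_simps)
    have ne: "(c = c - 1 + 1) = True" "(e = 1) = False" using e by auto
    have sum': "A + q1 = H + 2 - P + 2 * wh * (c + 1)" using sum e by simp
    have right: "lit wh 2 (A + P) \<noteq> lit wh 2 (q1 + P)"
      using g GR[unfolded ne if_False m] e by simp
    have "good ph qh Ver (a, b) \<longleftrightarrow> lit wh (2 - 2 * P) A \<noteq> lit wh (2 - 2 * P) q1"
      using GV[unfolded m] e by simp
    moreover note GB[unfolded ne if_True if_False, unfolded ne if_True if_False m] GT[unfolded ne if_True if_False, unfolded ne if_True if_False m]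
    ultimately show ?thesis using square_count_plus[OF odd_wh P H sum' right] by (simp only:)
  qed
  then show ?thesis using g unfolding card_good_edges a_def[symmetric] by simp
qed

end

section \<open>Number theory of the core predecessor\<close>

lemma ex_core:
  fixes p q \<tau> p' q' ph qh :: int and \<kappa> :: nat
  assumes ep: "even_param p q" and p1: "p > 1"
    and tune: "is_tune p q \<tau>" and kap: "is_kappa p q \<tau> \<kappa>" "\<kappa> \<ge> 1"
    and ev: "is_even_pred p q p' q'" and co: "(ph, qh) = core_pred p q \<kappa> p' q'"
  obtains e h t where "core p q p' q' ph qh (int \<kappa>) e (p + q) (p' + q') (ph + qh) h t"
proof -
  note eb = even_param_pos[OF ep]
  define w where "w = p + q"
  define w1 where "w1 = p' + q'"
  define e where "e = p * q' - p' * q"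
  have q': "0 < q'" and cop': "coprime p' q'" and evn: "even (p' * q')" and w1w: "w1 < w"
    using ev unfolding is_even_pred_def w_def w1_def by auto
  have e: "e = 1 \<or> e = -1" using ev unfolding is_even_pred_def e_def by linarith
  have w1_odd: "odd w1" unfolding w1_def by (rule odd_sum_of_coprime[OF cop' evn])
  have w_odd: "odd w" using eb unfolding w_def by simp
  have rel: "p * w1 = p' * w + e" unfolding w_def w1_def e_def by (simp add: algebra_simps)
  have relq: "q * w1 = q' * w - e" unfolding w_def w1_def e_def by (simp add: algebra_simps)
  have p'_pos: "p' \<ge> 1"
  proof (rule ccontr)
    assume "\<not> p' \<ge> 1"
    then have "p' * q \<le> 0" using eb by (simp add: mult_le_0_iff)
    moreover have "2 * 1 \<le> p * q'" using p1 q' by (intro mult_mono) auto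
    ultimately show False using e unfolding e_def by linarith
  qed
  have pq': "p' < q'"
  proof (rule ccontr)
    assume "\<not> p' < q'"
    moreover have "p' \<noteq> q'" using w1_odd unfolding w1_def by auto
    ultimately have "q' + 1 \<le> p'" by linarith
    then have "(q' + 1) * q \<le> p' * q" using eb by (intro mult_right_mono) auto
    moreover have "q' * (p + 1) \<le> q' * q" using eb q' by (intro mult_left_mono) auto
    ultimately have "e \<le> - q' - q" unfolding e_def by (simp add: algebra_simps)
    then show False using e q' eb by linarith
  qed
  have w1_3: "w1 \<ge> 3" using p'_pos pq' unfolding w1_def by linarith
  have pp: "odd (p + p')"
  proof
    assume s: "even (p + p')"
    have "even (q + q')" using s w_odd w1_odd unfolding w_def w1_def by presburger
    then have "even (p * q' - p' * q)" using s eb(3) by (auto simp: even_add)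
    moreover have "odd e" using e by auto
    ultimately show False unfolding e_def by blast
  qed
  have tau: "0 < \<tau>" "2 * \<tau> < w"
  proof -
    show "0 < \<tau>" using tune unfolding is_tune_def by simp
    have "(of_int (2 * \<tau>) :: real) < of_int w" using tune unfolding is_tune_def w_def by simp
    then show "2 * \<tau> < w" by (simp only: of_int_less_iff)
  qed
  \<comment> \<open>Both \<open>w1\<close> and \<open>2 * \<tau>\<close> invert \<open>p\<close>
    modulo \<open>w\<close> up to sign, so \<open>w\<close> divides their difference or their sum.
    The size bounds leave \<open>w1 = 2 * \<tau>\<close>, impossible as \<open>w1\<close> is odd, or
    \<open>w1 + 2 * \<tau> = w\<close>.\<close>
  have w1_tau: "w1 = w - 2 * \<tau>"
  proof -
    have "\<exists>d. (d = 1 \<or> d = -1) \<and> w dvd 2 * p * \<tau> - d"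
      using tune unfolding is_tune_def w_def cong_iff_dvd_diff by (metis)
    then obtain d where d: "d = 1 \<or> d = -1" and "w dvd 2 * p * \<tau> - d" by blast
    then obtain z where z: "2 * p * \<tau> - d = w * z" by (elim dvdE)
    have dd: "d * d = 1" using d by auto
    have "p * (w1 - e * d * (2 * \<tau>)) = p * w1 - e * d * (2 * p * \<tau>)" by (simp add: algebra_simps)
    also have "2 * p * \<tau> = w * z + d" using z by simp
    also have "p * w1 - e * d * (w * z + d) = w * (p' - e * d * z) + e - e * (d * d)"
      unfolding rel by (simp add: algebra_simps)
    also have "\<dots> = w * (p' - e * d * z)" unfolding dd by simp
    finally have "w dvd p * (w1 - e * d * (2 * \<tau>))" by simp
    moreover have "coprime w p" using eb(4) unfolding w_def by simp
    ultimately have dv: "w dvd w1 - e * d * (2 * \<tau>)" by (simp add: coprime_dvd_mult_right_iff)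
    have "e * d = 1 \<or> e * d = - 1" using e d by auto
    then show ?thesis
    proof
      assume "e * d = 1"
      then have "w dvd w1 - 2 * \<tau>" using dv by simp
      moreover have "\<bar>w1 - 2 * \<tau>\<bar> < w" using w1w w1_3 tau by linarith
      ultimately have "w1 - 2 * \<tau> = 0" using dvd_imp_le_int[of "w1 - 2 * \<tau>" w] by linarith
      then show ?thesis using w1_odd by presburger
    next
      assume "e * d = -1"
      then have "w dvd w1 + 2 * \<tau>" using dv by simp
      then obtain y where y: "w1 + 2 * \<tau> = w * y" by (elim dvdE)
      have "w * 0 < w * y" "w * y < w * 2" using y w1w w1_3 tau by linarith+
      then have "0 < y" "y < 2" using tau by (simp_all only: mult_less_cancel_left_pos)
      then have "y = 1" by linarith
      then show ?thesis using y by simp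
    qed
  qed
  define n where "n = int \<kappa>"
  have n: "n \<ge> 1" using kap unfolding n_def by simp
  have wpos: "0 < (of_int w :: real)" using tau by simp
  have k1: "n * w \<le> \<tau> * (2 * n + 1)"
  proof -
    have "real \<kappa> / (2 * real \<kappa> + 1) \<le> of_int \<tau> / of_int w" using kap unfolding is_kappa_def w_def by simp
    then have "real \<kappa> * of_int w \<le> of_int \<tau> * (2 * real \<kappa> + 1)" using wpos
      by (simp add: frac_le_eq divide_le_eq le_divide_eq mult.commute)
    then have "(of_int (n * w) :: real) \<le> of_int (\<tau> * (2 * n + 1))" unfolding n_def by simp
    then show ?thesis by (simp only: of_int_le_iff)
  qed
  have k2: "\<tau> * (2 * n + 3) < (n + 1) * w"
  proof -
    have "of_int \<tau> / of_int w < (real \<kappa> + 1) / (2 * (real \<kappa> + 1) + 1)" using kap unfolding is_kappa_def w_def by simp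
    then have "of_int \<tau> * (2 * (real \<kappa> + 1) + 1) < (real \<kappa> + 1) * of_int w" using wpos
      by (simp add: divide_less_eq less_divide_eq mult.commute)
    then have "(of_int (\<tau> * (2 * n + 3)) :: real) < of_int ((n + 1) * w)" unfolding n_def by (simp add: algebra_simps)
    then show ?thesis by (simp only: of_int_less_iff)
  qed
  define wh where "wh = ph + qh"
  have phq: "ph = p - 2 * n * p'" "qh = q - 2 * n * q'" using co unfolding core_pred_def n_def by auto
  have wh: "wh = w - 2 * n * w1" unfolding wh_def phq w_def w1_def by (simp add: algebra_simps)
  have tt: "2 * \<tau> = w - w1" using w1_tau by simp
  have k1': "n * w * 2 \<le> (w - w1) * (2 * n + 1)" unfolding tt[symmetric] using k1 by simp
  have k2': "(w - w1) * (2 * n + 3) < (n + 1) * w * 2" unfolding tt[symmetric] using k2 by simp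
  \<comment> \<open>With \<open>2 * \<tau> = w - w1\<close> and \<open>wh = w - 2 * n * w1\<close>,
    the two inequalities for \<kappa> become \<open>w1 \<le> wh\<close> and
    \<open>wh < 3 * w1\<close>.\<close>
  have wh_ge: "w1 \<le> wh" using k1' unfolding wh by (simp add: algebra_simps)
  have wh_lt: "wh < 3 * w1" using k2' unfolding wh by (simp add: algebra_simps)
  have wh_ne: "wh \<noteq> w1"
  proof
    assume "wh = w1"
    then have "w = (2 * n + 1) * w1" using wh by (simp add: algebra_simps)
    then have "e = w1 * (p - p' * (2 * n + 1))" using rel by (simp add: algebra_simps)
    then have "w1 dvd e" by simp
    then show False using e w1_3 zdvd_imp_le[of w1 1] by auto
  qed
  have relh: "ph * w1 = p' * wh + e" "qh * w1 = q' * wh - e"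
  proof -
    have "ph * w1 = p * w1 - p' * (2 * n * w1)" "qh * w1 = q * w1 - q' * (2 * n * w1)"
      unfolding phq by (simp_all add: algebra_simps)
    then show "ph * w1 = p' * wh + e" "qh * w1 = q' * wh - e" unfolding rel relq wh by (simp_all add: algebra_simps)
  qed
  have wh_gt: "w1 < wh" using wh_ge wh_ne by linarith
  then have wh4: "wh > 3" using w1_3 by linarith
  have eh: "even_param ph qh"
    unfolding even_param_def
  proof (intro conjI)
    have "1 * wh \<le> p' * wh" using p'_pos wh4 by (intro mult_right_mono) auto
    then have "ph * w1 > 0" unfolding relh using e wh4 by linarith
    then show "0 < ph" using w1_3 by (simp add: zero_less_mult_iff)
    have "1 * wh \<le> (q' - p') * wh" using pq' wh4 by (intro mult_right_mono) auto
    then have "wh \<le> q' * wh - p' * wh" by (simp add: left_diff_distrib)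
    then have "ph * w1 < qh * w1" unfolding relh using e wh4 by linarith
    then show "ph < qh" using w1_3 by simp
    \<comment> \<open>Subtracting a multiple of \<open>(p', q')\<close> preserves the determinant,
      so the core predecessor is again in lowest terms.\<close>
    have inv: "ph * q' - p' * qh = e" unfolding e_def phq by (simp add: algebra_simps)
    show "coprime ph qh"
    proof (rule coprimeI)
      fix c assume "c dvd ph" "c dvd qh"
      then have "c dvd ph * q' - p' * qh" by simp
      then show "is_unit c" unfolding inv using e by auto
    qed
    show "even (ph * qh)" using ep unfolding even_param_def phq by auto
  qed
  have wh_odd: "odd wh" using w_odd unfolding wh by simp
  have "even (w1 + 1)" "even (wh - w1)" using w1_odd wh_odd by simp_all
  then obtain h t where "w1 + 1 = 2 * h" "wh - w1 = 2 * t" by (elim evenE)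
  then have h: "w1 = 2 * h - 1" and t: "2 * t = wh - w1" by simp_all
  have "core p q p' q' ph qh n e w w1 wh h t"
    by unfold_locales (fact w_def w1_def wh_def ep eh phq n e rel h t w1_3 pp wh_gt wh_lt)+
  then show ?thesis using that unfolding n_def w_def w1_def wh_def by blast
qed

section \<open>The plaid polygons in a rectangle\<close>

lemma closed_segment_axis:
  fixes z :: "real \<times> real"
  shows "z \<in> closed_segment (x0, y0) (x0, y1) \<Longrightarrow> fst z = x0 \<and> snd z \<in> closed_segment y0 y1"
    "z \<in> closed_segment (x0, y0) (x1, y0) \<Longrightarrow> snd z = y0 \<and> fst z \<in> closed_segment x0 x1"
  using closed_segment_PairD[of "fst z" "snd z"] by fastforce+

text \<open>Restricted to the squares inside \<open>[0, t] \<times> [s, s + N]\<close>, the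
  connectors of the two parameters correspond square by square. Outside, a square may be drawn for
  one parameter and not for the other.\<close>

definition inner_connectors :: "int \<Rightarrow> int \<Rightarrow> int \<Rightarrow> int \<Rightarrow> int \<Rightarrow> (real \<times> real) set set" where
  "inner_connectors p q t s N =
     {closed_segment (square_center (a, b)) (seg_center A e) | a b A e.
        0 \<le> a \<and> a < t \<and> s \<le> b \<and> b < s + N \<and>
        card (good_edges p q (a, b)) = 2 \<and> (A, e) \<in> good_edges p q (a, b)}"

lemma inner_connectorsI:
  assumes "0 \<le> a" "a < t" "s \<le> b" "b < s + N" "card (good_edges p q (a, b)) = 2" "(A, e) \<in> good_edges p q (a, b)"
  shows "closed_segment (square_center (a, b)) (seg_center A e) \<in> inner_connectors p q t s N"
  unfolding inner_connectors_def using assms by blast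

lemma inner_connectorsE:
  assumes "S \<in> inner_connectors p q t s N"
  obtains a b A x y where "S = closed_segment (square_center (a, b)) (seg_center A (x, y))"
    "0 \<le> a" "a < t" "s \<le> b" "b < s + N" "card (good_edges p q (a, b)) = 2" "(A, (x, y)) \<in> good_edges p q (a, b)"
proof -
  obtain a b A e where *: "S = closed_segment (square_center (a, b)) (seg_center A e)"
    "0 \<le> a" "a < t" "s \<le> b" "b < s + N" "card (good_edges p q (a, b)) = 2" "(A, e) \<in> good_edges p q (a, b)"
    using assms unfolding inner_connectors_def by blast
  then show ?thesis by (cases e) (use that in blast)
qed

text \<open>A square outside the rectangle meets it at most in the center of a good edge on the boundary;
  by assumption such an edge lies on the right side, and the square to its left draws it too.\<close>

lemma rect_Int_connectors:
  assumes left: "\<And>b. s \<le> b \<Longrightarrow> b < s + N \<Longrightarrow> \<not> good p q Ver (0, b)"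
    and bot: "\<And>a. 0 \<le> a \<Longrightarrow> a < t \<Longrightarrow> \<not> good p q Hor (a, s)"
    and top: "\<And>a. 0 \<le> a \<Longrightarrow> a < t \<Longrightarrow> \<not> good p q Hor (a, s + N)"
    and right: "\<And>b. s \<le> b \<Longrightarrow> b < s + N \<Longrightarrow> good p q Ver (t, b) \<Longrightarrow> card (good_edges p q (t - 1, b)) = 2"
    and t: "t \<ge> 1"
  shows "({0..of_int t} \<times> {of_int s..of_int (s + N)}) \<inter> \<Union>(connectors p q) = \<Union>(inner_connectors p q t s N)"
    (is "?R \<inter> _ = _")
proof
  show "\<Union>(inner_connectors p q t s N) \<subseteq> ?R \<inter> \<Union>(connectors p q)"
  proof
    fix z assume "z \<in> \<Union>(inner_connectors p q t s N)"
    then obtain a b A e where z: "z \<in> closed_segment (square_center (a, b)) (seg_center A e)"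
      and ab: "0 \<le> a" "a < t" "s \<le> b" "b < s + N"
      and c: "card (good_edges p q (a, b)) = 2" and e: "(A, e) \<in> good_edges p q (a, b)"
      unfolding inner_connectors_def by blast
    have r: "0 \<le> real_of_int a" "real_of_int a + 1 \<le> of_int t" "real_of_int s \<le> of_int b" "real_of_int b + 1 \<le> of_int (s + N)"
      using ab by linarith+
    have sc: "square_center (a, b) \<in> ?R" unfolding square_center_def using r by auto
    have ec: "seg_center A e \<in> ?R"
      using e r unfolding good_edges_def square_edges_def by auto
    have "convex ?R" by (rule convex_Times) simp_all
    from closed_segment_subset[OF sc ec this] z have "z \<in> ?R" by (rule subsetD)
    moreover have "z \<in> \<Union>(connectors p q)" unfolding connectors_def using z c e by blast
    ultimately show "z \<in> ?R \<inter> \<Union>(connectors p q)" by blast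
  qed
  show "?R \<inter> \<Union>(connectors p q) \<subseteq> \<Union>(inner_connectors p q t s N)"
  proof
    fix z assume "z \<in> ?R \<inter> \<Union>(connectors p q)"
    then have zR: "0 \<le> fst z" "fst z \<le> of_int t" "of_int s \<le> snd z" "snd z \<le> of_int (s + N)"
      and zc: "z \<in> \<Union>(connectors p q)" by auto
    from zc obtain c0 A e where z0: "z \<in> closed_segment (square_center c0) (seg_center A e)"
      "card (good_edges p q c0) = 2" "(A, e) \<in> good_edges p q c0"
      unfolding connectors_def by blast
    obtain a b where "c0 = (a, b)" by (cases c0)
    with z0 have z: "z \<in> closed_segment (square_center (a, b)) (seg_center A e)"
      and c: "card (good_edges p q (a, b)) = 2" and e: "(A, e) \<in> good_edges p q (a, b)" by simp_all
    have inI: "z \<in> \<Union>(inner_connectors p q t s N)" if "0 \<le> a" "a < t" "s \<le> b" "b < s + N"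
      unfolding inner_connectors_def using z c e that by blast
    have e4: "A = Hor \<and> e = (a, b) \<or> A = Hor \<and> e = (a, b + 1) \<or> A = Ver \<and> e = (a, b) \<or> A = Ver \<and> e = (a + 1, b)"
      and g: "good p q A e"
      using e unfolding good_edges_def square_edges_def by auto
    note seg = closed_segment_eq_real_ivl
    from e4 consider "A = Hor" "e = (a, b)" | "A = Hor" "e = (a, b + 1)" | "A = Ver" "e = (a, b)" | "A = Ver" "e = (a + 1, b)"
      by blast
    then show "z \<in> \<Union>(inner_connectors p q t s N)"
    proof cases
      case 1
      have zz: "fst z = of_int a + 1 / 2" "of_int b \<le> snd z" "snd z \<le> of_int b + 1 / 2"
        using closed_segment_axis(1)[of z "of_int a + 1 / 2" "of_int b + 1 / 2" "of_int b"] z 1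
        by (auto simp: square_center_def seg split: if_splits)
      have "- 1 < (of_int a :: real)" "of_int a < (of_int t :: real)" using zz zR by linarith+
      then have a: "0 \<le> a" "a < t" by linarith+
      have "of_int s < (of_int (b + 1) :: real)" "of_int b \<le> (of_int (s + N) :: real)"
        using zz zR unfolding of_int_add[of b] by linarith+
      then have b: "s < b + 1" "b \<le> s + N" by (simp_all only: of_int_less_iff of_int_le_iff)
      have "b \<noteq> s + N" using top[OF a] g 1 by auto
      then show ?thesis using inI a b by simp
    next
      case 2
      have zz: "fst z = of_int a + 1 / 2" "of_int b + 1 / 2 \<le> snd z" "snd z \<le> of_int b + 1"
        using closed_segment_axis(1)[of z "of_int a + 1 / 2" "of_int b + 1 / 2" "of_int b + 1"] z 2
        by (auto simp: square_center_def seg split: if_splits)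
      have "- 1 < (of_int a :: real)" "of_int a < (of_int t :: real)" using zz zR by linarith+
      then have a: "0 \<le> a" "a < t" by linarith+
      have "of_int s \<le> (of_int (b + 1) :: real)" "of_int b < (of_int (s + N) :: real)"
        using zz zR unfolding of_int_add[of b] by linarith+
      then have b: "s \<le> b + 1" "b < s + N" by (simp_all only: of_int_less_iff of_int_le_iff)
      have "b + 1 \<noteq> s" using bot[OF a] g 2 by auto
      then show ?thesis using inI a b by simp
    next
      case 3
      have zz: "snd z = of_int b + 1 / 2" "of_int a \<le> fst z" "fst z \<le> of_int a + 1 / 2"
        using closed_segment_axis(2)[of z "of_int a + 1 / 2" "of_int b + 1 / 2" "of_int a"] z 3
        by (auto simp: square_center_def seg split: if_splits)
      have "of_int s < (of_int (b + 1) :: real)" "of_int b < (of_int (s + N) :: real)"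
        using zz zR unfolding of_int_add[of b] by linarith+
      then have b: "s \<le> b" "b < s + N" by (simp_all only: of_int_less_iff of_int_le_iff zle_add1_eq_le)
      have "- 1 < (of_int a :: real)" "of_int a \<le> (of_int t :: real)" using zz zR by linarith+
      then have a: "0 \<le> a" "a \<le> t" by linarith+
      show ?thesis
      proof (cases "a = t")
        case True
        have c2: "card (good_edges p q (t - 1, b)) = 2" using right[OF b] g 3 True by simp
        have m: "(Ver, (t, b)) \<in> good_edges p q (t - 1, b)"
          using g 3 True unfolding good_edges_def square_edges_def by auto
        have "z = seg_center Ver (t, b)" using zz zR True by (simp add: prod_eq_iff)
        then have "z \<in> closed_segment (square_center (t - 1, b)) (seg_center Ver (t, b))" by (simp only: ends_in_segment)
        moreover have "closed_segment (square_center (t - 1, b)) (seg_center Ver (t, b)) \<in> inner_connectors p q t s N"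
          by (rule inner_connectorsI[OF _ _ b c2 m]) (use t in simp_all)
        ultimately show ?thesis by (rule UnionI[rotated])
      next
        case False
        then show ?thesis using inI a b by simp
      qed
    next
      case 4
      have zz: "snd z = of_int b + 1 / 2" "of_int a + 1 / 2 \<le> fst z" "fst z \<le> of_int a + 1"
        using closed_segment_axis(2)[of z "of_int a + 1 / 2" "of_int b + 1 / 2" "of_int a + 1"] z 4
        by (auto simp: square_center_def seg split: if_splits)
      have "of_int s < (of_int (b + 1) :: real)" "of_int b < (of_int (s + N) :: real)"
        using zz zR unfolding of_int_add[of b] by linarith+
      then have b: "s \<le> b" "b < s + N" by (simp_all only: of_int_less_iff of_int_le_iff zle_add1_eq_le)
      have "- 2 < (of_int a :: real)" "of_int a < (of_int t :: real)" using zz zR by linarith+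
      then have a: "- 1 \<le> a" "a < t" by linarith+
      have "a \<noteq> - 1" using left[OF b] g 4 by auto
      then show ?thesis using inI a b by simp
    qed
  qed
qed

section \<open>The two rectangles and the translation between them\<close>

context core begin

definition "s = n * w1"

lemma t_pos: "t \<ge> 1" using t_def w1_less by linarith

lemma good_edges_shift:
  assumes a: "0 \<le> a" "a < t" and b: "0 \<le> b" "b < wh"
  shows "card (good_edges p q (a, b + s)) = card (good_edges ph qh (a, b))"
    "(A, (x, y + s)) \<in> good_edges p q (a, b + s) \<longleftrightarrow> (A, (x, y)) \<in> good_edges ph qh (a, b)"
proof -
  have a2: "2 * a \<le> wh - w1" "2 * (a + 1) \<le> wh - w1" "0 \<le> a + 1" and b2: "b \<le> wh" "0 \<le> b + 1" "b + 1 \<le> wh"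
    using a b t_def by simp_all
  have r: "b + s + 1 = b + 1 + s" by simp
  have V: "good p q Ver (a, b + s) = good ph qh Ver (a, b)"
    unfolding s_def by (rule good_Ver_shift[OF a(1) a2(1) b])
  have V': "good p q Ver (a + 1, b + s) = good ph qh Ver (a + 1, b)"
    unfolding s_def by (rule good_Ver_shift[OF a2(3,2) b])
  have H: "good p q Hor (a, b + s) = good ph qh Hor (a, b)"
    unfolding s_def by (rule good_Hor_shift[OF a(1) a2(2) b(1) b2(1)])
  have H': "good p q Hor (a, b + 1 + s) = good ph qh Hor (a, b + 1)"
    unfolding s_def by (rule good_Hor_shift[OF a(1) a2(2) b2(2,3)])
  show "card (good_edges p q (a, b + s)) = card (good_edges ph qh (a, b))"
    unfolding card_good_edges r V V' H H' ..
  have i: "y + s = b + s \<longleftrightarrow> y = b" "y + s = b + 1 + s \<longleftrightarrow> y = b + 1" by auto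
  show "(A, (x, y + s)) \<in> good_edges p q (a, b + s) \<longleftrightarrow> (A, (x, y)) \<in> good_edges ph qh (a, b)"
    unfolding good_edges_def square_edges_def using V V' H H' r i by auto
qed

lemma Upsilon_eq: "Upsilon w wh = (\<lambda>z. (0, of_int s) + z)"
proof -
  have "w - wh = 2 * s" unfolding s_def w_eq by simp
  then have "of_int (w - wh) / 2 = (of_int s :: real)" by simp
  then show ?thesis unfolding Upsilon_def by (auto simp: fun_eq_iff)
qed

lemma inner_connectors_shift:
  "\<Union>(inner_connectors p q t s wh) = Upsilon w wh ` \<Union>(inner_connectors ph qh t 0 wh)"
proof -
  have seg: "closed_segment (square_center (a, b + s)) (seg_center A (x, y + s)) =
      Upsilon w wh ` closed_segment (square_center (a, b)) (seg_center A (x, y))" for a b A x y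
  proof -
    have "square_center (a, b + s) = (0, of_int s) + square_center (a, b)"
      unfolding square_center_def by simp
    moreover have "seg_center A (x, y + s) = (0, of_int s) + seg_center A (x, y)"
      by (cases A) auto
    ultimately show ?thesis unfolding Upsilon_eq by (simp only: closed_segment_translation)
  qed
  have "inner_connectors p q t s wh = (`) (Upsilon w wh) ` inner_connectors ph qh t 0 wh"
  proof (intro equalityI subsetI)
    fix S assume "S \<in> inner_connectors p q t s wh"
    then obtain a b A x y where S: "S = closed_segment (square_center (a, b)) (seg_center A (x, y))"
      and ab: "0 \<le> a" "a < t" "s \<le> b" "b < s + wh"
      and c: "card (good_edges p q (a, b)) = 2" and e: "(A, (x, y)) \<in> good_edges p q (a, b)"
      by (rule inner_connectorsE)
    have b: "0 \<le> b - s" "b - s < wh" using ab by auto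
    have bs: "b - s + s = b" "y - s + s = y" by simp_all
    have c': "card (good_edges ph qh (a, b - s)) = 2"
      using good_edges_shift(1)[OF ab(1,2) b] c unfolding bs by (simp only:)
    have e': "(A, (x, y - s)) \<in> good_edges ph qh (a, b - s)"
      using good_edges_shift(2)[OF ab(1,2) b, of A x "y - s"] e unfolding bs by (simp only:)
    have "closed_segment (square_center (a, b - s)) (seg_center A (x, y - s)) \<in> inner_connectors ph qh t 0 wh"
      by (rule inner_connectorsI[OF ab(1,2) b(1) _ c' e']) (use b in simp)
    moreover have "S = Upsilon w wh ` closed_segment (square_center (a, b - s)) (seg_center A (x, y - s))"
      unfolding S seg[symmetric] bs ..
    ultimately show "S \<in> (`) (Upsilon w wh) ` inner_connectors ph qh t 0 wh" by blast
  next
    fix S assume "S \<in> (`) (Upsilon w wh) ` inner_connectors ph qh t 0 wh"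
    then obtain S0 where S0: "S0 \<in> inner_connectors ph qh t 0 wh" "S = Upsilon w wh ` S0" by blast
    from S0(1) obtain a b A x y where "S0 = closed_segment (square_center (a, b)) (seg_center A (x, y))"
      and ab: "0 \<le> a" "a < t" "0 \<le> b" "b < 0 + wh"
      and c: "card (good_edges ph qh (a, b)) = 2" and e: "(A, (x, y)) \<in> good_edges ph qh (a, b)"
      by (rule inner_connectorsE)
    then have S: "S = Upsilon w wh ` closed_segment (square_center (a, b)) (seg_center A (x, y))"
      using S0(2) by (simp only:)
    have b: "b < wh" "s \<le> b + s" "b + s < s + wh" using ab by auto
    have c': "card (good_edges p q (a, b + s)) = 2"
      using good_edges_shift(1)[OF ab(1-3) b(1)] c by (simp only:)
    have e': "(A, (x, y + s)) \<in> good_edges p q (a, b + s)"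
      using good_edges_shift(2)[OF ab(1-3) b(1)] e by (simp only:)
    show "S \<in> inner_connectors p q t s wh"
      unfolding S seg[symmetric] by (rule inner_connectorsI[OF ab(1,2) b(2,3) c' e'])
  qed
  then show ?thesis by (simp add: image_Union)
qed

lemma left_not_good: "\<not> good ph qh Ver (0, b)"
proof -
  have "\<not> lit wh (4 * ph * 0) m" for m using not_lit_zero_cap[of 0] by simp
  moreover have "2 * 0 < wh" using wh_gt w1_ge by linarith
  ultimately show ?thesis using good_Ver[OF eh order_refl, of b, folded wh_def] by blast
qed

lemma plaid_rect_hat:
  "({0..of_int t} \<times> {of_int 0..of_int (0 + wh)}) \<inter> \<Union>(connectors ph qh) = \<Union>(inner_connectors ph qh t 0 wh)"
proof (rule rect_Int_connectors)
  fix a assume "0 \<le> a" "a < t"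
  then have a: "0 \<le> a" "2 * (a + 1) \<le> wh - w1" using t_def by auto
  show "\<not> good ph qh Hor (a, 0)" "\<not> good ph qh Hor (a, 0 + wh)"
    using not_good_boundary[OF a, of 0] not_good_boundary[OF a, of wh] by simp_all
next
  fix b
  show "\<not> good ph qh Ver (0, b)" by (rule left_not_good)
  show "card (good_edges ph qh (t - 1, b)) = 2" if "good ph qh Ver (t, b)" using that by (rule square_two_good)
qed (rule t_pos)

lemma plaid_rect:
  "({0..of_int t} \<times> {of_int s..of_int (s + wh)}) \<inter> \<Union>(connectors p q) = \<Union>(inner_connectors p q t s wh)"
proof (rule rect_Int_connectors)
  fix a assume a': "0 \<le> a" "a < t"
  then have a: "0 \<le> a" "2 * (a + 1) \<le> wh - w1" using t_def by auto
  have wh: "0 \<le> wh" using wh_gt w1_ge by linarith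
  show "\<not> good p q Hor (a, s)"
    using good_Hor_shift[OF a order_refl wh, folded s_def] not_good_boundary[OF a disjI1[OF refl]] unfolding add_0_left by blast
  show "\<not> good p q Hor (a, s + wh)"
    using good_Hor_shift[OF a wh order_refl, folded s_def] not_good_boundary[OF a disjI2[OF refl]]
    unfolding add.commute[of wh s] by blast
next
  fix b assume "s \<le> b" "b < s + wh"
  then have b: "0 \<le> b - s" "b - s < wh" by auto
  have V: "good p q Ver (a, b) \<longleftrightarrow> good ph qh Ver (a, b - s)" if "0 \<le> a" "2 * a \<le> wh - w1" for a
    using good_Ver_shift[OF that b, folded s_def] by (simp only: diff_add_cancel)
  have "2 * 0 \<le> wh - w1" using w1_less by linarith
  from V[OF order_refl this] show "\<not> good p q Ver (0, b)" using left_not_good by blast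
  assume "good p q Ver (t, b)"
  moreover have "0 \<le> t" "2 * t \<le> wh - w1" using t_pos t_def by linarith+
  ultimately have "good ph qh Ver (t, b - s)" using V by blast
  then have c: "card (good_edges ph qh (t - 1, b - s)) = 2" by (rule square_two_good)
  have "0 \<le> t - 1" "t - 1 < t" using t_pos by linarith+
  from good_edges_shift(1)[OF this b] c show "card (good_edges p q (t - 1, b)) = 2"
    by (simp only: diff_add_cancel)
qed (rule t_pos)

lemma plaid_copy:
  "Upsilon w wh ` R_rect ph qh \<inter> plaid_union p q = Upsilon w wh ` (R_rect ph qh \<inter> plaid_union ph qh)"
proof -
  have R: "R_rect ph qh = {0..of_int t} \<times> {of_int 0..of_int (0 + wh)}"
    unfolding R_rect_def right_line_eq wh_def by simp
  have UR: "Upsilon w wh ` R_rect ph qh = {0..of_int t} \<times> {of_int s..of_int (s + wh)}"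
  proof (intro equalityI subsetI)
    fix z :: "real \<times> real" assume "z \<in> {0..of_int t} \<times> {of_int s..of_int (s + wh)}"
    then have "(fst z, snd z - of_int s) \<in> R_rect ph qh" "z = Upsilon w wh (fst z, snd z - of_int s)"
      unfolding R Upsilon_eq by (auto simp: prod_eq_iff)
    then show "z \<in> Upsilon w wh ` R_rect ph qh" by blast
  qed (auto simp: R Upsilon_eq)
  have u: "plaid_union p q = \<Union>(connectors p q)" for p q
    unfolding plaid_union_def plaid_polygons_def by (rule Union_components)
  have hat: "R_rect ph qh \<inter> \<Union>(connectors ph qh) = \<Union>(inner_connectors ph qh t 0 wh)"
    unfolding R by (rule plaid_rect_hat)
  show ?thesis unfolding UR u hat plaid_rect by (rule inner_connectors_shift)
qed

end

theorem lemma6p2: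
  fixes p q \<tau> p' q' ph qh :: int and \<kappa> :: nat
  assumes "even_param p q" and "p > 1"
    and "is_tune p q \<tau>" and "is_kappa p q \<tau> \<kappa>" and "\<kappa> \<ge> 1"
    and "is_even_pred p q p' q'" and "(ph, qh) = core_pred p q \<kappa> p' q'"
  defines "\<Upsilon> \<equiv> Upsilon (p + q) (ph + qh)"
    and "\<Sigma>h \<equiv> R_rect ph qh"
  defines "\<Sigma> \<equiv> \<Upsilon> ` \<Sigma>h"
  shows "\<Sigma> \<inter> plaid_union p q = \<Upsilon> ` (\<Sigma>h \<inter> plaid_union ph qh)"
proof -
  obtain e h t where "core p q p' q' ph qh (int \<kappa>) e (p + q) (p' + q') (ph + qh) h t"
    by (rule ex_core[OF assms(1-7)])
  then show ?thesis unfolding \<Sigma>_def \<Sigma>h_def \<Upsilon>_def by (rule core.plaid_copy)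
qed

end
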